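(* There is a universal constant $K_{\mathrm{KS}}>0$ such that the following holds. Suppose $u_1,\dots,u_n\in\mathbb R^d$ satisfy $\sum_{i=1}^n u_iu_i^{\mathsf T}=I_d$ and $\max_i\|u_i\|_2^2\le\varepsilon\le 1$. Then there is a partition $[n]=I_+\sqcup I_-$ such that for both choices of sign $$\Bigl\|\sum_{i\in I_\pm}u_iu_i^{\mathsf T}-\tfrac12 I_d\Bigr\|\le K_{\mathrm{KS}}\sqrt{\varepsilon}.$$
   Context: $\|\cdot\|$ is the operator norm and $[n]=\{1,\dots,n\}$. "Universal" means independent of $n$, $d$, $\varepsilon$ and the vectors. *)

theory Defs
  imports Complex_Main "Jordan_Normal_Form.Matrix"
begin

(* The constant of the theorem must not depend on the dimension, so d cannot be a type
   parameter; vectors and matrices with explicit carriers are used instead. *)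

definition vec_norm2 :: "real vec \<Rightarrow> real" where
  "vec_norm2 x = sqrt (x \<bullet> x)"

(* Operator norm with respect to the Euclidean norms. The set is nonempty (zero vector) and
   bounded above (see below), so the supremum is genuine, also in dimension 0. *)
definition mat_opnorm :: "real mat \<Rightarrow> real" where
  "mat_opnorm A =
     Sup {vec_norm2 (A *\<^sub>v x) | x. x \<in> carrier_vec (dim_col A) \<and> vec_norm2 x \<le> 1}"

(* mat_of_row v is v\<^sup>T, so this is the dim_vec v by dim_vec v matrix v v\<^sup>T. *)
definition outer_square :: "real vec \<Rightarrow> real mat" where
  "outer_square v = transpose_mat (mat_of_row v) * mat_of_row v"

(* Matrices of all sizes share one type, which has no zero; hence the analogue of finsum_vec. *)
definition finsum_mat ::
  "'a :: monoid_add itself \<Rightarrow> nat \<Rightarrow> nat \<Rightarrow> ('c \<Rightarrow> 'a mat) \<Rightarrow> 'c set \<Rightarrow> 'a mat" where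
  "finsum_mat ty nr nc = finprod (monoid_mat ty nr nc)"

lemma outer_square_carrier:
  assumes "v \<in> carrier_vec d"
  shows "outer_square v \<in> carrier_mat d d"
  using assms by (auto simp: outer_square_def)

lemma index_outer_square:
  assumes "v \<in> carrier_vec d" "i < d" "j < d"
  shows "outer_square v $$ (i, j) = v $ i * v $ j"
  using assms by (simp add: outer_square_def scalar_prod_def)

lemma index_finsum_mat:
  fixes f :: "'c \<Rightarrow> 'a :: comm_monoid_add mat"
  assumes "finite S" "f \<in> S \<rightarrow> carrier_mat nr nc" "i < nr" "j < nc"
  shows "finsum_mat TYPE('a) nr nc f S $$ (i, j) = (\<Sum>s\<in>S. f s $$ (i, j))"
proof -
  interpret comm_monoid "monoid_mat TYPE('a) nr nc" by (rule comm_monoid_mat)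
  have "finsum_mat TYPE('a) nr nc f S \<in> carrier_mat nr nc \<and>
      finsum_mat TYPE('a) nr nc f S $$ (i, j) = (\<Sum>s\<in>S. f s $$ (i, j))"
    using assms(1,2)
  proof (induction S rule: finite_induct)
    case empty
    have "finsum_mat TYPE('a) nr nc f {} = 0\<^sub>m nr nc"
      unfolding finsum_mat_def finprod_empty by (simp add: monoid_mat_def)
    then show ?case using assms(3,4) by simp
  next
    case (insert s S)
    then have "finsum_mat TYPE('a) nr nc f (insert s S) = f s + finsum_mat TYPE('a) nr nc f S"
      unfolding finsum_mat_def
      by (subst finprod_insert) (auto simp: monoid_mat_def Pi_def)
    then show ?case using insert assms(3,4) by (auto simp: Pi_def)
  qed
  then show ?thesis ..
qed

lemma bdd_above_mat_opnorm:
  "bdd_above {vec_norm2 (A *\<^sub>v x) | x. x \<in> carrier_vec (dim_col A) \<and> vec_norm2 x \<le> 1}"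
proof -
  have "vec_norm2 (A *\<^sub>v x) \<le>
      sqrt (\<Sum>i<dim_row A. (\<Sum>j<dim_col A. \<bar>A $$ (i, j)\<bar>)\<^sup>2)"
    if x: "x \<in> carrier_vec (dim_col A)" and n: "vec_norm2 x \<le> 1" for x
  proof -
    have e: "\<bar>x $ j\<bar> \<le> 1" if j: "j < dim_col A" for j
    proof -
      have "(x $ j)\<^sup>2 \<le> (\<Sum>k<dim_col A. (x $ k)\<^sup>2)"
        using j by (intro member_le_sum) auto
      also have "\<dots> = x \<bullet> x"
        using x by (auto simp: scalar_prod_def power2_eq_square atLeast0LessThan)
      also have "\<dots> \<le> 1" using n by (simp add: vec_norm2_def)
      finally show ?thesis by (simp add: abs_square_le_1)
    qed
    have r: "\<bar>(A *\<^sub>v x) $ i\<bar> \<le> (\<Sum>j<dim_col A. \<bar>A $$ (i, j)\<bar>)" if i: "i < dim_row A" for i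
    proof -
      have "(A *\<^sub>v x) $ i = (\<Sum>j<dim_col A. A $$ (i, j) * x $ j)"
        using i x by (auto simp: scalar_prod_def atLeast0LessThan)
      also have "\<bar>\<dots>\<bar> \<le> (\<Sum>j<dim_col A. \<bar>A $$ (i, j) * x $ j\<bar>)" by (rule sum_abs)
      also have "\<dots> \<le> (\<Sum>j<dim_col A. \<bar>A $$ (i, j)\<bar>)"
        using e by (intro sum_mono) (auto simp: abs_mult intro: mult_left_le)
      finally show ?thesis .
    qed
    have "(A *\<^sub>v x) \<bullet> (A *\<^sub>v x) = (\<Sum>i<dim_row A. \<bar>(A *\<^sub>v x) $ i\<bar>\<^sup>2)"
      by (simp add: scalar_prod_def power2_eq_square atLeast0LessThan)
    also have "\<dots> \<le> (\<Sum>i<dim_row A. (\<Sum>j<dim_col A. \<bar>A $$ (i, j)\<bar>)\<^sup>2)"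
      using r by (intro sum_mono power_mono) auto
    finally show ?thesis by (simp add: vec_norm2_def)
  qed
  then show ?thesis by (intro bdd_aboveI) blast
qed

end

theory Submission
  imports "HOL-Complex_Analysis.Conformal_Mappings" "Jordan_Normal_Form.Determinant" Defs
begin

text \<open>
The theorem is the solution of the Kadison--Singer problem by Marcus, Spielman and Srivastava in
Weaver's form; the proof is a variant of theirs that works with multiaffine functions only.

Put \<open>D z = det (\<Sum>i. z i u\<^sub>i u\<^sub>i\<^sup>T)\<close>. Because of \<open>\<Sum>i. u\<^sub>i u\<^sub>i\<^sup>T = I\<close>, the number
\<open>D z\<close> is the characteristic polynomial at \<open>x\<close> of twice the sum over \<open>S\<close> if \<open>z i = x - 2\<close> for \<open>i \<in> S\<close>
and \<open>z i = x\<close> otherwise. One therefore wants a set \<open>S\<close> for which the product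
\<open>D z * D w\<close>, with \<open>z\<close> belonging to \<open>S\<close> and \<open>w\<close> to its complement, has no real zero
\<open>x \<ge> 1 + 5 \<surd>\<epsilon>\<close>. Then both partial sums are at most \<open>1/2 + 5/2 \<surd>\<epsilon>\<close>, and since they add up to
\<open>I\<close>, both are also at least \<open>1/2 - 5/2 \<surd>\<epsilon>\<close>.

Two facts about the expectation of this product over random sets \<open>S\<close> carry the proof.

\<^item> If every index chooses its part by a fair coin, the expectation is positive for all
  \<open>x \<ge> 1 + 5 \<surd>\<epsilon>\<close> (\<open>det_half_average_positive\<close>). Averaging over one index acts as
  \<open>1 - \<partial>\<^sub>z - \<partial>\<^sub>w\<close> on its two variables. The barrier method follows the logarithmic
  derivatives at a point above the zeros (\<open>barrier_step\<close>): they start at no more than \<open>\<epsilon> / c\<close>, and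
  raising two variables by \<open>t\<close> compensates for the operator.

\<^item> Some outcome is as good as the expectation (\<open>exists_positive_selection\<close>). For arbitrary coin
  biases the expectation has no zeros off the real axis, and it is affine in each bias; an argument with
  the open mapping theorem (\<open>pencil_positive_endpoint\<close>) then moves one bias after the other from
  \<open>1/2\<close> to \<open>0\<close> or \<open>1\<close>.

Both rest on stability: \<open>D\<close> does not vanish when all variables lie in the upper half plane, averaging
preserves this property (\<open>stable_pair_average\<close>), and at real points it implies the inequalities behind the
barrier method (\<open>rayleigh_real_part_fun\<close>).
\<close>

no_notation inner (infix "\<bullet>" 70)
no_notation Finite_Cartesian_Product.vec_nth (infixl "$" 90)
hide_const (open) Determinants.det

section \<open>Multiaffine functions\<close>

text \<open>
For a function that is affine in coordinate \<open>i\<close> this difference is the partial derivative.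
Differences keep the calculus of multiaffine functions purely algebraic, over the reals and over
the complex numbers alike.
\<close>

definition pd :: "'i \<Rightarrow> (('i \<Rightarrow> 'a) \<Rightarrow> 'a) \<Rightarrow> ('i \<Rightarrow> 'a) \<Rightarrow> 'a :: comm_ring_1" where
  "pd i f y = f (y(i := 1)) - f (y(i := 0))"

definition multiaffine :: "(('i \<Rightarrow> 'a) \<Rightarrow> 'a :: comm_ring_1) \<Rightarrow> bool" where
  "multiaffine f \<longleftrightarrow> (\<forall>y i s. f (y(i := s)) = f (y(i := 0)) + s * pd i f y)"

lemma multiaffineD: "multiaffine f \<Longrightarrow> f (y(i := s)) = f (y(i := 0)) + s * pd i f y"
  unfolding multiaffine_def by blast

lemma pd_upd_same: "pd i f (y(i := s)) = pd i f y"
  by (simp add: pd_def)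

lemma diff_right_commute_pairs: "(a - b) - (c - d) = (a - c) - (b - (d :: 'a :: ab_group_add))"
  by (simp add: algebra_simps)

lemma pd_commute: "pd i (pd j f) y = pd j (pd i f) y"
proof (cases "i = j")
  case False
  show ?thesis unfolding pd_def fun_upd_twist[OF False] by (rule diff_right_commute_pairs)
qed simp

lemma multiaffine_pd: "multiaffine f \<Longrightarrow> multiaffine (pd k f)"
  unfolding multiaffine_def
proof (intro allI)
  fix y i s
  assume "\<forall>y i s. f (y(i := s)) = f (y(i := 0)) + s * pd i f y"
  then have f: "f (y(i := s)) = f (y(i := 0)) + s * pd i f y" for y i s by blast
  show "pd k f (y(i := s)) = pd k f (y(i := 0)) + s * pd i (pd k f) y"
  proof (cases "i = k")
    case False
    have e: "f (y(k := v, i := s)) = f (y(k := v, i := 0)) + s * (f (y(k := v, i := 1)) - f (y(k := v, i := 0)))" for v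
      using f[of "y(k := v)" i s] by (simp add: pd_def)
    show ?thesis
      unfolding pd_def fun_upd_twist[OF False] e[of 0] e[of 1] by (simp add: algebra_simps)
  qed (simp add: pd_def)
qed

lemma multiaffine_shift: "multiaffine f \<Longrightarrow> f (y(i := y i + h)) = f y + h * pd i f y"
proof -
  assume f: "multiaffine f"
  have "f (y(i := y i + h)) = f (y(i := 0)) + (y i + h) * pd i f y"
    by (rule multiaffineD[OF f])
  also have "\<dots> = (f (y(i := 0)) + y i * pd i f y) + h * pd i f y"
    by (simp only: distrib_right add.assoc)
  also have "f (y(i := 0)) + y i * pd i f y = f y"
    using multiaffineD[OF f, of y i "y i"] by simp
  finally show ?thesis .
qed

text \<open>
Two coordinates that move together turn a multiaffine function into a quadratic polynomial. The
barrier argument takes place on such diagonals, because both copies of a vector move at once.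
\<close>

lemma multiaffine_shift_pair:
  assumes f: "multiaffine f" and ij: "i \<noteq> j"
  shows "f (y(i := y i + h, j := y j + h)) = f y + (pd i f y + pd j f y) * h + pd i (pd j f) y * h\<^sup>2"
proof -
  have "f (y(i := y i + h, j := y j + h)) = f (y(i := y i + h)) + h * pd j f (y(i := y i + h))"
    using multiaffine_shift[OF f, of "y(i := y i + h)" j h] ij by simp
  then show ?thesis
    unfolding multiaffine_shift[OF f] multiaffine_shift[OF multiaffine_pd[OF f]]
    by (simp add: algebra_simps power2_eq_square)
qed

lemma pd_shift_pair:
  assumes f: "multiaffine f" and ij: "i \<noteq> j"
  shows "pd i f (y(i := y i + h, j := y j + h)) = pd i f y + pd i (pd j f) y * h"
    and "pd j f (y(i := y i + h, j := y j + h)) = pd j f y + pd i (pd j f) y * h"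
proof -
  have "pd i f (y(i := y i + h, j := y j + h)) = pd i f (y(j := y j + h))"
    unfolding fun_upd_twist[OF ij] by (rule pd_upd_same)
  then show "pd i f (y(i := y i + h, j := y j + h)) = pd i f y + pd i (pd j f) y * h"
    unfolding multiaffine_shift[OF multiaffine_pd[OF f]] by (simp add: pd_commute[of i] mult.commute)
  show "pd j f (y(i := y i + h, j := y j + h)) = pd j f y + pd i (pd j f) y * h"
    unfolding pd_upd_same multiaffine_shift[OF multiaffine_pd[OF f]] by (simp add: mult.commute)
qed

section \<open>Barriers for multiaffine functions with the Rayleigh property\<close>

text \<open>
Where \<open>f\<close> is positive, the inequality says that every logarithmic derivative of \<open>f\<close> is
antitone in every coordinate. It is a polynomial inequality, required at all real points: the
estimate of a barrier step evaluates it beyond the region where \<open>f\<close> is positive. The finite set \<open>V\<close> of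
relevant coordinates lets one move from one point to another in finitely many single steps.
\<close>

locale rayleigh =
  fixes V :: "'i set" and f :: "('i \<Rightarrow> real) \<Rightarrow> real"
  assumes finite_vars: "finite V"
    and depends: "(\<And>i. i \<in> V \<Longrightarrow> y i = y' i) \<Longrightarrow> f y = f y'"
    and multiaffine: "multiaffine f"
    and rayleigh: "f y * pd i (pd j f) y \<le> pd i f y * pd j f y"
begin

lemmas shift = multiaffine_shift[OF multiaffine]
lemmas pd_shift = multiaffine_shift[OF multiaffine_pd[OF multiaffine]]

text \<open>
Above a barrier \<open>c\<close> the function stays positive along each upward ray, on which it is affine; so
its slope cannot be negative. The same reasoning applies to the first derivatives.
\<close>

lemma pd_nonneg:
  assumes pos: "\<And>y. (\<And>i. c \<le> y i) \<Longrightarrow> 0 < f y" and y: "\<And>i. c \<le> y i"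
  shows "0 \<le> pd k f y"
proof (rule ccontr)
  assume "\<not> 0 \<le> pd k f y"
  then have n: "pd k f y < 0" by simp
  define h where "h = f y / - pd k f y"
  have h: "h \<ge> 0" using pos[of y] y n unfolding h_def by (simp add: less_imp_le divide_nonneg_neg)
  have "f (y(k := y k + h)) = 0" using n unfolding shift h_def by simp
  moreover have "f (y(k := y k + h)) > 0" using y h by (intro pos) (simp add: add_increasing2)
  ultimately show False by simp
qed

lemma pd_pd_nonneg:
  assumes pos: "\<And>y. (\<And>i. c \<le> y i) \<Longrightarrow> 0 < f y" and y: "\<And>i. c \<le> y i"
  shows "0 \<le> pd i (pd k f) y"
proof (rule ccontr)
  assume "\<not> 0 \<le> pd i (pd k f) y"
  then have n: "pd i (pd k f) y < 0" by simp
  define h where "h = (pd k f y + 1) / - pd i (pd k f) y"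
have k0: "0 \<le> pd k f y" by (rule pd_nonneg[where c = c]) (use pos y in auto)  have h: "h \<ge> 0" using n k0 unfolding h_def by (intro divide_nonneg_pos) auto
  have "pd k f (y(i := y i + h)) = -1" using n unfolding pd_shift h_def by (simp add: field_simps)
  moreover have "0 \<le> pd k f (y(i := y i + h))"
    using y h by (intro pd_nonneg[where c=c] pos) (auto simp add: add_increasing2)
  ultimately show False by simp
qed

text \<open>
Both numerator and denominator are affine in the step \<open>h\<close>, so cross-multiplication leaves exactly
the Rayleigh inequality.
\<close>

lemma potential_antimono_coordinate:
  assumes pos: "\<And>y. (\<And>i. c \<le> y i) \<Longrightarrow> 0 < f y" and y: "\<And>i. c \<le> y i" and h: "0 \<le> h"
  shows "pd k f (y(i := y i + h)) / f (y(i := y i + h)) \<le> pd k f y / f y"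
proof -
  have f1: "0 < f y" using pos y by blast
  have f2: "0 < f (y(i := y i + h))" using y h by (intro pos) (simp add: add_increasing2)
  have "h * (f y * pd i (pd k f) y) \<le> h * (pd i f y * pd k f y)"
    using rayleigh h by (intro mult_left_mono) auto
  then have "pd k f (y(i := y i + h)) * f y \<le> pd k f y * f (y(i := y i + h))"
    unfolding shift pd_shift by (simp add: algebra_simps)
  then show ?thesis using f1 f2 by (simp add: divide_simps mult.commute)
qed

lemma potential_antimono:
  assumes pos: "\<And>y. (\<And>i. c \<le> y i) \<Longrightarrow> 0 < f y" and y: "\<And>i. c \<le> y i"
  shows "pd k f y / f y \<le> pd k f (\<lambda>_. c) / f (\<lambda>_. c)"
proof -
  have *: "pd k f (\<lambda>i. if i \<in> A then y i else c) / f (\<lambda>i. if i \<in> A then y i else c)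
     \<le> pd k f (\<lambda>_. c) / f (\<lambda>_. c)" if "finite A" for A
    using that
  proof (induction A)
    case (insert a A)
    let ?y = "\<lambda>i. if i \<in> A then y i else c"
    have "(\<lambda>i. if i \<in> insert a A then y i else c) = ?y(a := ?y a + (y a - c))"
      using insert by auto
    then show ?case
      using potential_antimono_coordinate[of c ?y "y a - c" k a] pos y insert.IH by fastforce
  qed simp
  have e: "f ((\<lambda>i. if i \<in> V then y i else c)(a := s)) = f (y(a := s))" for a s
    by (rule depends) auto
  have "f (\<lambda>i. if i \<in> V then y i else c) = f y" by (rule depends) auto
  then show ?thesis using *[OF finite_vars] by (simp add: pd_def e)
qed

end

lemma nonneg_quadratic_discriminant:
  fixes a b c :: real
  assumes "\<And>x. 0 \<le> a + 2 * b * x + c * x\<^sup>2"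
  shows "b\<^sup>2 \<le> a * c" "0 \<le> a" "0 \<le> c"
proof -
  show a: "0 \<le> a" using assms[of 0] by simp
  have main: "b\<^sup>2 \<le> a * c \<and> 0 \<le> c"
  proof (cases "c = 0")
    case True
    have "b = 0"
    proof (rule ccontr)
      assume b: "b \<noteq> 0"
      show False using assms[of "-(a+1)/(2*b)"] True b by (simp add: field_simps)
    qed
    then show ?thesis using True by simp
  next
    case False
    have "0 \<le> a + 2 * b * (-b/c) + c * (-b/c)\<^sup>2" by (rule assms)
    also have "\<dots> = a - b\<^sup>2 / c" using False by (simp add: field_simps power2_eq_square)
    finally have 1: "b\<^sup>2 / c \<le> a" by simp
    have "c > 0"
    proof (rule ccontr)
      assume "\<not> c > 0"
      then have c: "c < 0" using False by simp
      define x where "x = sqrt ((a + 1) / - c)"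
      have "x\<^sup>2 = (a + 1) / - c" using a c by (simp add: x_def divide_nonneg_neg)
      then have "c * x\<^sup>2 = - (a + 1)" using c by (simp add: field_simps)
      moreover have "0 \<le> a + 2 * b * x + c * x\<^sup>2" "0 \<le> a + 2 * b * (- x) + c * (- x)\<^sup>2"
        by (rule assms)+
      ultimately show False by simp
    qed
    then show ?thesis using 1 by (simp add: field_simps)
  qed
  then show "b\<^sup>2 \<le> a * c" "0 \<le> c" by auto
qed

text \<open>
The heart of a barrier step, for the restrictions \<open>M s = 1 + m1 s + m2 s\<^sup>2\<close> and
\<open>N s = n0 + n1 s + n2 s\<^sup>2\<close> of a function and of one of its derivatives to a diagonal. The claim is
\<open>(N - N') / (M - M') \<le> N (-t) / M (-t)\<close> with the left side taken at \<open>0\<close>: to subtract the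
derivative costs no more potential than a shift by \<open>t\<close> gains.

Write \<open>n0 M - N = a s + g s\<^sup>2\<close>. The left side is \<open>n0 + a / (1 - m1)\<close>, at most \<open>n0 + t a\<close>, so it
is enough that \<open>N / M\<close> lies above its tangent at \<open>0\<close>, and this reduces to
\<open>g \<le> a (m1 - t m2)\<close>. If \<open>g > 0\<close>, the quotient \<open>N / M\<close> takes the value \<open>n0\<close> again at the zero
\<open>- a / g\<close> of \<open>a s + g s\<^sup>2\<close>, with slope \<open>a / M (- a / g)\<close>; as it is antitone,
\<open>M (- a / g) \<le> 0\<close>. So \<open>- a / g < - t\<close>, and both inequalities together bound \<open>g\<close>.
\<close>

lemma barrier_quotient_normalized:
  fixes n0 n1 n2 m1 m2 t :: real
  assumes t: "0 < t" "1 \<le> t * (1 - m1)" and m2: "0 \<le> m2" "t * m2 \<le> m1"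
    and pos: "\<And>s. - t \<le> s \<Longrightarrow> 0 < 1 + m1 * s + m2 * s\<^sup>2"
    and mono: "\<And>s. (n1 + 2 * n2 * s) * (1 + m1 * s + m2 * s\<^sup>2)
                 \<le> (n0 + n1 * s + n2 * s\<^sup>2) * (m1 + 2 * m2 * s)"
  shows "(n0 - n1) * (1 - m1 * t + m2 * t\<^sup>2) \<le> (n0 - n1 * t + n2 * t\<^sup>2) * (1 - m1)"
proof -
  define a where "a = n0 * m1 - n1"
  define g where "g = n0 * m2 - n2"
  define k where "k = n1 * m2 - n2 * m1"
  have k: "k = m1 * g - m2 * a" by (simp add: a_def g_def k_def algebra_simps)
  \<comment> \<open>The numerator of the negated derivative of \<open>N / M\<close>; its discriminant encodes \<open>M (- a / g) \<le> 0\<close>.\<close>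
  have "0 \<le> a + 2 * g * s + k * s\<^sup>2" for s
    using mono[of s] by (simp add: a_def g_def k_def algebra_simps power2_eq_square)
  from nonneg_quadratic_discriminant[OF this]
  have disc: "g\<^sup>2 \<le> a * (m1 * g - m2 * a)" and a: "0 \<le> a" by (auto simp: k)
  define M where "M = 1 - m1 * t + m2 * t\<^sup>2"
  have M: "0 < M" using pos[of "-t"] by (simp add: M_def)
  have M1: "t * (m1 - t * m2) = 1 - M" by (simp add: M_def power2_eq_square algebra_simps)
  have Dt: "1 \<le> (1 - m1) * t" using t by (simp add: mult.commute)
  have "0 < t * (1 - m1)" using t by linarith
  then have D: "0 < 1 - m1" using t(1) by (simp only: zero_less_mult_iff) auto
  have g: "g \<le> a * (m1 - t * m2)"
  proof (cases "g \<le> 0")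
    case True
    have "0 \<le> a * (m1 - t * m2)" using a m2 by simp
    then show ?thesis using True by linarith
  next
    case False
    then have g0: "0 < g" by simp
    have a0: "a \<noteq> 0" using disc mult_pos_pos[OF g0 g0] by (auto simp: power2_eq_square)
    then have a0: "0 < a" using a by simp
    have "t * g < a"
    proof (rule ccontr)
      assume "\<not> t * g < a"
      then have "- t \<le> - (a / g)" using g0 by (simp add: field_simps)
      from pos[OF this] have "0 < (1 + m1 * - (a / g) + m2 * (- (a / g))\<^sup>2) * g\<^sup>2" using g0 by simp
      also have "\<dots> = g\<^sup>2 - a * (m1 * g - m2 * a)" using g0 by (simp add: field_simps power2_eq_square)
      finally show False using disc by simp
    qed
    then have "m2 * a * (t * g) \<le> m2 * a * a" using m2 a by (intro mult_left_mono) auto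
    then have "g * g \<le> g * (a * (m1 - t * m2))" using disc by (simp add: power2_eq_square algebra_simps)
    then show ?thesis using g0 by simp
  qed
  have "(n0 - n1) * M - (n0 - n1 * t + n2 * t\<^sup>2) * (1 - m1) = a * M - (1 - m1) * t * a + (1 - m1) * t * (t * g)"
    by (simp add: M_def a_def g_def power2_eq_square algebra_simps)
  also have "\<dots> \<le> a * M - (1 - m1) * t * a + (1 - m1) * t * (t * (a * (m1 - t * m2)))"
    using g t D by (intro add_left_mono mult_left_mono) auto
  also have "\<dots> = a * M * (1 - (1 - m1) * t)"
  proof -
    have "t * (a * (m1 - t * m2)) = a * (1 - M)" using M1 by (metis mult.left_commute)
    then show ?thesis by (simp only:) (simp add: algebra_simps)
  qed
  also have "\<dots> \<le> 0" using a M Dt by (intro mult_nonneg_nonpos) auto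
  finally show ?thesis by (simp add: M_def)
qed

lemma barrier_quotient:
  fixes n0 n1 n2 m0 m1 m2 t :: real
  assumes t: "0 < t" "m0 \<le> t * (m0 - m1)" and m: "0 < m0" "0 \<le> m2" "t * m2 \<le> m1"
    and pos: "\<And>s. - t \<le> s \<Longrightarrow> 0 < m0 + m1 * s + m2 * s\<^sup>2"
    and mono: "\<And>s. (n1 + 2 * n2 * s) * (m0 + m1 * s + m2 * s\<^sup>2)
                 \<le> (n0 + n1 * s + n2 * s\<^sup>2) * (m1 + 2 * m2 * s)"
  shows "(n0 - n1) * (m0 - m1 * t + m2 * t\<^sup>2) \<le> (n0 - n1 * t + n2 * t\<^sup>2) * (m0 - m1)"
proof -
  have "(n0/m0 - n1/m0) * (1 - m1/m0 * t + m2/m0 * t\<^sup>2) \<le> (n0/m0 - n1/m0 * t + n2/m0 * t\<^sup>2) * (1 - m1/m0)"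
  proof (rule barrier_quotient_normalized)
    show "1 \<le> t * (1 - m1/m0)" using t m by (simp add: field_simps)
    show "t * (m2/m0) \<le> m1/m0" using m by (simp add: divide_right_mono)
    fix s
    have e: "1 + m1/m0 * s + m2/m0 * s\<^sup>2 = (m0 + m1 * s + m2 * s\<^sup>2) / m0"
        "n1/m0 + 2 * (n2/m0) * s = (n1 + 2 * n2 * s) / m0"
        "n0/m0 + n1/m0 * s + n2/m0 * s\<^sup>2 = (n0 + n1 * s + n2 * s\<^sup>2) / m0"
        "m1/m0 + 2 * (m2/m0) * s = (m1 + 2 * m2 * s) / m0"
      using m by (simp_all add: field_simps)
    show "0 < 1 + m1/m0 * s + m2/m0 * s\<^sup>2" if "- t \<le> s"
      unfolding e using pos[OF that] m by simp
    show "(n1/m0 + 2 * (n2/m0) * s) * (1 + m1/m0 * s + m2/m0 * s\<^sup>2) \<le>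
        (n0/m0 + n1/m0 * s + n2/m0 * s\<^sup>2) * (m1/m0 + 2 * (m2/m0) * s)"
      unfolding e times_divide_times_eq using mono[of s] m by (intro divide_right_mono) auto
  qed (use t m in auto)
  then have "(n0/m0 - n1/m0) * (1 - m1/m0 * t + m2/m0 * t\<^sup>2) * m0\<^sup>2
     \<le> (n0/m0 - n1/m0 * t + n2/m0 * t\<^sup>2) * (1 - m1/m0) * m0\<^sup>2"
    by (intro mult_right_mono) auto
  moreover have "(n0/m0 - n1/m0) * (1 - m1/m0 * t + m2/m0 * t\<^sup>2) * m0\<^sup>2 = (n0 - n1) * (m0 - m1 * t + m2 * t\<^sup>2)"
    using m by (simp add: field_simps power2_eq_square)
  moreover have "(n0/m0 - n1/m0 * t + n2/m0 * t\<^sup>2) * (1 - m1/m0) * m0\<^sup>2 = (n0 - n1 * t + n2 * t\<^sup>2) * (m0 - m1)"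
    using m by (simp add: field_simps power2_eq_square)
  ultimately show ?thesis by simp
qed

context rayleigh begin

text \<open>
One step of the barrier argument. The function \<open>f'\<close> averages over the two ways to lower one of the
coordinates \<open>z\<close>, \<open>w\<close> by \<open>2\<close>; on a multiaffine function this is the operator
\<open>1 - \<partial>\<^sub>z - \<partial>\<^sub>w\<close>, evaluated at \<open>z = w = c + t\<close>. The coordinates \<open>z\<close> and \<open>w\<close> are
thus raised from \<open>c\<close> to \<open>c + t\<close> before the operator acts, and this leaves all potentials below
the old bound \<open>\<Phi>\<close> as soon as \<open>t\<close> is at least \<open>1 / (1 - 2 \<Phi>)\<close>.
\<close>

lemma barrier_step:
  fixes c t \<Phi> :: real and z w :: 'i
  defines "f' \<equiv> \<lambda>y. (f (y(z := c + t - 2, w := c + t)) + f (y(z := c + t, w := c + t - 2))) / 2"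
  assumes pos: "\<And>y. (\<And>i. c \<le> y i) \<Longrightarrow> 0 < f y"
    and potential: "\<And>k. pd k f (\<lambda>_. c) \<le> \<Phi> * f (\<lambda>_. c)"
    and zw: "z \<noteq> w" and \<Phi>: "0 \<le> \<Phi>" and t: "0 < t" "1 \<le> t * (1 - 2 * \<Phi>)"
  shows "\<And>y. (\<And>i. c \<le> y i) \<Longrightarrow> 0 < f' y"
    and "pd k f' (\<lambda>_. c) \<le> \<Phi> * f' (\<lambda>_. c)"
proof -
  define Y where "Y y = y(z := c + t, w := c + t)" for y :: "'i \<Rightarrow> real"
  have f': "f' y = f (Y y) - pd z f (Y y) - pd w f (Y y)" for y
  proof -
    have "f (y(z := c + t - 2, w := c + t)) = f ((Y y)(z := Y y z + - 2))"
      using zw by (simp add: Y_def fun_upd_twist)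
    moreover have "f (y(z := c + t, w := c + t - 2)) = f ((Y y)(w := Y y w + - 2))"
      by (simp add: Y_def)
    ultimately show ?thesis unfolding f'_def by (simp only: shift) (simp add: field_simps)
  qed
  have D: "0 < 1 - 2 * \<Phi>"
  proof -
    have "0 < t * (1 - 2 * \<Phi>)" using t by linarith
    then show ?thesis using t(1) by (simp only: zero_less_mult_iff) auto
  qed
  have Yc: "c \<le> Y y i" if "\<And>i. c \<le> y i" for y i
    using that t by (simp add: Y_def)
  have pd_bound: "pd k f y \<le> \<Phi> * f y" if "\<And>i. c \<le> y i" for y k
  proof -
    have "0 < f (\<lambda>_. c)" by (rule pos) simp
    then have "pd k f (\<lambda>_. c) / f (\<lambda>_. c) \<le> \<Phi>" using potential[of k] by (simp add: divide_simps)
    moreover have "pd k f y / f y \<le> pd k f (\<lambda>_. c) / f (\<lambda>_. c)"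
      by (rule potential_antimono[where c = c]) (use pos that in auto)
    ultimately have "pd k f y / f y \<le> \<Phi>" by linarith
    then show ?thesis using pos[of y] that by (simp add: divide_simps)
  qed
  have pos_bound: "(1 - 2 * \<Phi>) * f (Y y) \<le> f' y" if "\<And>i. c \<le> y i" for y
    using pd_bound[of "Y y" z] pd_bound[of "Y y" w] Yc[OF that] by (simp add: f' algebra_simps)
  show pos': "0 < f' y" if "\<And>i. c \<le> y i" for y
  proof -
    have "0 < f (Y y)" using Yc[OF that] by (intro pos)
    then have "0 < (1 - 2 * \<Phi>) * f (Y y)" using D by simp
    then show ?thesis using pos_bound[of y, OF that] by linarith
  qed
  show "pd k f' (\<lambda>_. c) \<le> \<Phi> * f' (\<lambda>_. c)"
  proof (cases "k = z \<or> k = w")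
    case True
    then have "pd k f' (\<lambda>_. c) = 0"
      using zw by (auto simp: pd_def f'_def fun_upd_twist)
    then show ?thesis using pos'[of "\<lambda>_. c"] \<Phi> by simp
  next
    case False
    define y where "y = Y (\<lambda>_. c)"
    define Ys where "Ys s = y(z := y z + s, w := y w + s)" for s
    have cy: "c \<le> y i" for i unfolding y_def by (rule Yc) simp
    have cYs: "c \<le> Ys s i" if "- t \<le> s" for s i
      using that t by (simp add: Ys_def y_def Y_def)
    have Yst: "Ys (- t) = (\<lambda>_. c)" using zw by (auto simp: Ys_def y_def Y_def)
    define m0 m1 m2 where "m0 = f y" and "m1 = pd z f y + pd w f y" and "m2 = pd z (pd w f) y"
    define n0 n1 n2 where "n0 = pd k f y" and "n1 = pd z (pd k f) y + pd w (pd k f) y"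
      and "n2 = pd z (pd w (pd k f)) y"
    note ma = multiaffine multiaffine_pd[OF multiaffine]
    have M: "f (Ys s) = m0 + m1 * s + m2 * s\<^sup>2" for s
      unfolding Ys_def m0_def m1_def m2_def by (rule multiaffine_shift_pair[OF ma(1) zw])
    have N: "pd k f (Ys s) = n0 + n1 * s + n2 * s\<^sup>2" for s
      unfolding Ys_def n0_def n1_def n2_def by (rule multiaffine_shift_pair[OF ma(2) zw])
    have M': "pd z f (Ys s) + pd w f (Ys s) = m1 + 2 * m2 * s" for s
      unfolding Ys_def m1_def m2_def pd_shift_pair[OF ma(1) zw] by simp
    have N': "pd z (pd k f) (Ys s) + pd w (pd k f) (Ys s) = n1 + 2 * n2 * s" for s
      unfolding Ys_def n1_def n2_def pd_shift_pair[OF ma(2) zw] by simp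
    have f'c: "f' (\<lambda>_. c) = m0 - m1"
      by (simp add: f' m0_def m1_def y_def)
    have Yk: "Y (v(k := s)) = (Y v)(k := s)" for v s
      using False by (auto simp: Y_def)
    have f'k: "pd k f' (\<lambda>_. c) = n0 - n1"
      unfolding n0_def n1_def pd_commute[of _ k]
      by (simp add: pd_def[of k] f' Yk y_def)
    have "(n0 - n1) * (m0 - m1 * t + m2 * t\<^sup>2) \<le> (n0 - n1 * t + n2 * t\<^sup>2) * (m0 - m1)"
    proof (rule barrier_quotient)
      show "0 < m0" unfolding m0_def using cy by (rule pos)
      show "0 \<le> m2" unfolding m2_def by (rule pd_pd_nonneg[where c = c]) (use pos cy in auto)
      have m1: "m1 \<le> 2 * \<Phi> * m0"
        unfolding m1_def m0_def using pd_bound[of y z] pd_bound[of y w] cy by simp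
      have "m0 \<le> t * (1 - 2 * \<Phi>) * m0" using t \<open>0 < m0\<close> by simp
      also have "\<dots> \<le> t * (m0 - m1)" using m1 t by (simp add: algebra_simps)
      finally show "m0 \<le> t * (m0 - m1)" .
      have "0 \<le> pd z f (Ys (- t))"
        by (rule pd_nonneg[where c = c]) (use pos cYs[of "-t"] in auto)
      then have "t * m2 \<le> pd z f y"
        unfolding Ys_def pd_shift_pair[OF ma(1) zw] m2_def by (simp add: mult.commute)
      moreover have "0 \<le> pd w f y"
        by (rule pd_nonneg[where c = c]) (use pos cy in auto)
      ultimately show "t * m2 \<le> m1" unfolding m1_def by linarith
      show "0 < m0 + m1 * s + m2 * s\<^sup>2" if "- t \<le> s" for s
        unfolding M[symmetric] using cYs[OF that] by (rule pos)
      show "(n1 + 2 * n2 * s) * (m0 + m1 * s + m2 * s\<^sup>2) \<le> (n0 + n1 * s + n2 * s\<^sup>2) * (m1 + 2 * m2 * s)" for s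
        unfolding M[symmetric] N[symmetric] M'[symmetric] N'[symmetric]
        using rayleigh[of "Ys s" z k] rayleigh[of "Ys s" w k] by (simp add: algebra_simps)
    qed (use t in auto)
    also have "n0 - n1 * t + n2 * t\<^sup>2 = pd k f (\<lambda>_. c)" using N[of "-t"] by (simp add: Yst)
    also have "pd k f (\<lambda>_. c) * (m0 - m1) \<le> (\<Phi> * f (\<lambda>_. c)) * (m0 - m1)"
      using potential pos'[of "\<lambda>_. c"] by (intro mult_right_mono) (auto simp: f'c)
    also have "m0 - m1 * t + m2 * t\<^sup>2 = f (\<lambda>_. c)" using M[of "-t"] by (simp add: Yst)
    finally have "(n0 - n1) * f (\<lambda>_. c) \<le> (\<Phi> * (m0 - m1)) * f (\<lambda>_. c)" by (simp add: mult_ac)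
    moreover have "0 < f (\<lambda>_. c)" by (rule pos) simp
    ultimately show ?thesis by (simp add: f'c f'k)
  qed
qed

end

section \<open>Stable multiaffine functions\<close>

text \<open>
A stable function has no zeros when all its variables lie in the open upper half plane. The
variable \<open>x\<close>, in which \<open>F\<close> may have any degree, holds the common value of all coordinates that
have been averaged out; a separate variable keeps the function affine in the remaining ones.
Holomorphy along complex lines provides the continuity and the open mapping used later.
\<close>

locale stable_multiaffine =
  fixes V :: "'i set" and F :: "complex \<Rightarrow> ('i \<Rightarrow> complex) \<Rightarrow> complex"
  assumes finite_vars: "finite V"
    and depends: "(\<And>i. i \<in> V \<Longrightarrow> y i = y' i) \<Longrightarrow> F x y = F x y'"
    and multiaffine: "multiaffine (F x)"
    and nonzero: "0 < Im x \<Longrightarrow> (\<And>i. 0 < Im (y i)) \<Longrightarrow> F x y \<noteq> 0"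
    and cnj: "F (cnj x) (\<lambda>i. cnj (y i)) = cnj (F x y)"
    and holomorphic: "(\<lambda>t. F (a + t * b) (\<lambda>i. p i + t * q i)) holomorphic_on UNIV"
begin

text \<open>
In coordinate \<open>i\<close> the function is affine with its only zero at \<open>y i - F x y / pd i (F x) y\<close>,
which stability keeps out of the upper half plane.
\<close>

lemma Im_pd_ratio:
  assumes x: "0 < Im x" and y: "\<And>i. 0 < Im (y i)" and B: "pd i (F x) y \<noteq> 0"
  shows "Im (pd i (F x) y / F x y) < 0"
proof -
  define s where "s = - (F x y / pd i (F x) y)"
  have "F x (y(i := y i + s)) = 0"
    unfolding multiaffine_shift[OF multiaffine] using B by (simp add: s_def)
  moreover have "F x (y(i := y i + s)) \<noteq> 0" if "0 < Im (y i + s)"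
    using x that y by (intro nonzero) auto
  ultimately have "\<not> 0 < Im (y i + s)" by blast
  then have "0 < Im (F x y / pd i (F x) y)" using y[of i] by (simp add: s_def)
  moreover have "pd i (F x) y / F x y = inverse (F x y / pd i (F x) y)" by simp
  ultimately show ?thesis
    by (simp only: inverse_complex.sel) (auto intro!: divide_neg_pos simp: sum_power2_gt_zero_iff)
qed

lemma Im_pd_ratio_nonpos:
  assumes "0 < Im x" and "\<And>i. 0 < Im (y i)"
  shows "Im (pd i (F x) y / F x y) \<le> 0"
proof (cases "pd i (F x) y = 0")
  case False
  show ?thesis using Im_pd_ratio[of x y, OF assms False] by simp
qed simp

end

text \<open>
The expectation over the two ways to lower one of \<open>z\<close>, \<open>w\<close> by \<open>2\<close>, where \<open>z\<close> is lowered with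
probability \<open>\<theta>\<close>. The values \<open>0\<close> and \<open>1\<close> of \<open>\<theta>\<close> are the two deterministic choices.
\<close>

definition pair_average :: "real \<Rightarrow> 'i \<Rightarrow> 'i \<Rightarrow> (complex \<Rightarrow> ('i \<Rightarrow> complex) \<Rightarrow> complex)
    \<Rightarrow> complex \<Rightarrow> ('i \<Rightarrow> complex) \<Rightarrow> complex" where
  "pair_average \<theta> z w F x y = of_real \<theta> * F x (y(z := x - 2, w := x))
     + of_real (1 - \<theta>) * F x (y(z := x, w := x - 2))"

text \<open>
The average equals \<open>A - 2 \<theta> B - 2 (1 - \<theta>) C\<close> for the value \<open>A\<close> and the derivatives \<open>B\<close>, \<open>C\<close>
at \<open>z = w = x\<close>. Each of \<open>B / A\<close> and \<open>C / A\<close> is zero or has negative imaginary part, so the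
average divided by \<open>A\<close> is \<open>1\<close> or has positive imaginary part.
\<close>

lemma (in stable_multiaffine) stable_pair_average:
  assumes zw: "z \<noteq> w" and \<theta>: "0 \<le> \<theta>" "\<theta> \<le> 1"
  shows "stable_multiaffine V (pair_average \<theta> z w F)"
proof
  show "finite V" by (rule finite_vars)
next
  fix x and y y' :: "'i \<Rightarrow> complex"
  assume e: "\<And>i. i \<in> V \<Longrightarrow> y i = y' i"
  have "F x (y(z := a, w := b)) = F x (y'(z := a, w := b))" for a b
    by (rule depends) (use e in auto)
  then show "pair_average \<theta> z w F x y = pair_average \<theta> z w F x y'"
    by (simp add: pair_average_def)
next
  fix x
  show "multiaffine (pair_average \<theta> z w F x)"
    unfolding multiaffine_def
  proof (intro allI)
    fix y i s
    have *: "F x (y(i := s, z := a, w := b)) = F x (y(i := 0, z := a, w := b))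
       + s * (F x (y(i := 1, z := a, w := b)) - F x (y(i := 0, z := a, w := b)))" for a b
    proof (cases "i = z \<or> i = w")
      case True
      then show ?thesis using zw by (auto simp: fun_upd_twist)
    next
      case False
      then have "y(i := v, z := a, w := b) = y(z := a, w := b, i := v)" for v by auto
      then show ?thesis
        using multiaffineD[OF multiaffine, of x "y(z := a, w := b)" i s] by (simp add: pd_def)
    qed
    show "pair_average \<theta> z w F x (y(i := s)) =
        pair_average \<theta> z w F x (y(i := 0)) + s * pd i (pair_average \<theta> z w F x) y"
      unfolding pair_average_def pd_def *[of "x-2" x] *[of x "x-2"] by (simp add: algebra_simps)
  qed
next
  fix x and y :: "'i \<Rightarrow> complex"
  assume x: "0 < Im x" and y: "\<And>i. 0 < Im (y i)"
  define Y where "Y = y(z := x, w := x)"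
  have Y: "0 < Im (Y i)" for i using x y by (simp add: Y_def)
  define A B C where "A = F x Y" and "B = pd z (F x) Y" and "C = pd w (F x) Y"
  have A: "A \<noteq> 0" unfolding A_def using x Y by (rule nonzero)
  have B: "Im (B / A) \<le> 0" "B \<noteq> 0 \<Longrightarrow> Im (B / A) < 0"
    and C: "Im (C / A) \<le> 0" "C \<noteq> 0 \<Longrightarrow> Im (C / A) < 0"
    unfolding A_def B_def C_def using Im_pd_ratio_nonpos[of x Y, OF x Y] Im_pd_ratio[of x Y, OF x Y] by auto
  have "y(z := x - 2, w := x) = Y(z := Y z + - 2)"
    using zw by (simp add: Y_def fun_upd_twist)
  moreover have "y(z := x, w := x - 2) = Y(w := Y w + - 2)"
    by (simp add: Y_def)
  ultimately have val: "pair_average \<theta> z w F x y = A - of_real (2 * \<theta>) * B - of_real (2 * (1 - \<theta>)) * C"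
    unfolding pair_average_def A_def B_def C_def
    by (simp only: multiaffine_shift[OF multiaffine]) (simp add: algebra_simps)
  show "pair_average \<theta> z w F x y \<noteq> 0"
  proof
    assume "pair_average \<theta> z w F x y = 0"
    have Im_combination: "r * Im u + s * Im v = 0" if "of_real r * u + of_real s * v = 1" for r s u v
      using arg_cong[OF that, of Im] by simp
    from \<open>pair_average \<theta> z w F x y = 0\<close> have 1: "of_real (2 * \<theta>) * (B / A) + of_real (2 * (1 - \<theta>)) * (C / A) = 1"
      unfolding val using A by (simp add: field_simps)
    then have "2 * \<theta> * Im (B / A) + 2 * (1 - \<theta>) * Im (C / A) = 0"
      by (rule Im_combination)
    moreover have "2 * \<theta> * Im (B / A) \<le> 0" "2 * (1 - \<theta>) * Im (C / A) \<le> 0"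
      using \<theta> B C by (auto intro!: mult_nonneg_nonpos)
    ultimately have "2 * \<theta> * Im (B / A) = 0" "2 * (1 - \<theta>) * Im (C / A) = 0" by linarith+
    then have "\<theta> = 0 \<or> B = 0" "1 - \<theta> = 0 \<or> C = 0" using B C by force+
    then show False using 1 by auto
  qed
next
  fix x y
  have *: "F (cnj x) ((\<lambda>i. cnj (y i))(z := cnj a, w := cnj b)) = cnj (F x (y(z := a, w := b)))" for a b
    unfolding cnj[symmetric] by (rule arg_cong[where f = "F (cnj x)"]) (auto simp: fun_eq_iff)
  show "pair_average \<theta> z w F (cnj x) (\<lambda>i. cnj (y i)) = cnj (pair_average \<theta> z w F x y)"
    unfolding pair_average_def using *[of x "x - 2"] *[of "x - 2" x] by simp
next
  fix a b p q
  have "(\<lambda>t. of_real \<theta> * F (a + t * b) (\<lambda>i. (p(z := a - 2, w := a)) i + t * (q(z := b, w := b)) i)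
     + of_real (1 - \<theta>) * F (a + t * b) (\<lambda>i. (p(z := a, w := a - 2)) i + t * (q(z := b, w := b)) i))
     holomorphic_on UNIV"
    by (intro holomorphic_intros holomorphic)
  moreover have "(\<lambda>i. (p(z := a - 2, w := a)) i + t * (q(z := b, w := b)) i)
       = (\<lambda>i. p i + t * q i)(z := a + t * b - 2, w := a + t * b)"
     "(\<lambda>i. (p(z := a, w := a - 2)) i + t * (q(z := b, w := b)) i)
       = (\<lambda>i. p i + t * q i)(z := a + t * b, w := a + t * b - 2)" for t
    by auto
  ultimately show "(\<lambda>t. pair_average \<theta> z w F (a + t * b) (\<lambda>i. p i + t * q i)) holomorphic_on UNIV"
    by (simp only: pair_average_def)
qed

definition real_part_fun :: "(complex \<Rightarrow> ('i \<Rightarrow> complex) \<Rightarrow> complex) \<Rightarrow> real \<Rightarrow> ('i \<Rightarrow> real) \<Rightarrow> real" where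
  "real_part_fun F a y = Re (F (of_real a) (\<lambda>i. of_real (y i)))"

context stable_multiaffine begin

lemma of_real_real_part_fun: "F (of_real a) (\<lambda>i. of_real (y i)) = of_real (real_part_fun F a y)"
proof -
  have "cnj (F (of_real a) (\<lambda>i. of_real (y i))) = F (of_real a) (\<lambda>i. of_real (y i))"
    using cnj[of "of_real a" "\<lambda>i. of_real (y i)"] by simp
  then show ?thesis
    by (simp add: real_part_fun_def complex_eq_iff)
qed

lemma of_real_fun_upd: "(\<lambda>i. complex_of_real ((y(k := s)) i)) = (\<lambda>i. of_real (y i))(k := of_real s)"
  by auto

lemma of_real_pd: "pd k (F (of_real a)) (\<lambda>i. of_real (y i)) = of_real (pd k (real_part_fun F a) y)"
  unfolding pd_def of_real_diff of_real_real_part_fun[symmetric] of_real_fun_upd by simp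

lemma multiaffine_real_part_fun: "multiaffine (real_part_fun F a)"
  unfolding multiaffine_def
proof (intro allI)
  fix y i s
  have "complex_of_real (real_part_fun F a (y(i := s))) =
      of_real (real_part_fun F a (y(i := 0)) + s * pd i (real_part_fun F a) y)"
    unfolding of_real_add of_real_mult of_real_pd[symmetric]
    unfolding of_real_real_part_fun[symmetric] of_real_fun_upd
    using multiaffineD[OF multiaffine, of "of_real a" "\<lambda>i. of_real (y i)" i "of_real s"] by simp
  then show "real_part_fun F a (y(i := s)) = real_part_fun F a (y(i := 0)) + s * pd i (real_part_fun F a) y"
    by (simp only: of_real_eq_iff)
qed

text \<open>
A stable function with real coefficients has the Rayleigh property. With all but two variables
frozen it has the form \<open>A + B u + C v + E u v\<close>. If \<open>B C < A E\<close> at a real point, then the zero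
\<open>u\<close> that belongs to \<open>v = \<i>\<close> lies strictly in the upper half plane. It remains there when the
frozen variables are raised by a small \<open>\<eta> \<i>\<close>, against stability.
\<close>

lemma rayleigh_real_part_fun: "rayleigh V (real_part_fun F a)"
proof
  show "finite V" by (rule finite_vars)
  show "real_part_fun F a y = real_part_fun F a y'" if "\<And>i. i \<in> V \<Longrightarrow> y i = y' i" for y y'
    unfolding real_part_fun_def using that by (intro arg_cong[where f = Re] depends) simp
  show "multiaffine (real_part_fun F a)" by (rule multiaffine_real_part_fun)
  let ?f = "real_part_fun F a"
  show "?f y * pd i (pd j ?f) y \<le> pd i ?f y * pd j ?f y" for y i j
  proof (cases "i = j")
    case True
    then show ?thesis by (simp add: pd_def)
  next
    case False
    define p where "p u v = (\<lambda>l. complex_of_real (y l))(i := u, j := v)" for u v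
    define q where "q = (\<lambda>l. \<i>)(i := 0, j := 0)"
    define G where "G u v \<eta> = F (of_real a + of_real \<eta> * \<i>) (\<lambda>l. p u v l + of_real \<eta> * q l)"
      for u v and \<eta> :: real
    define B C E where "B \<eta> = G 1 0 \<eta> - G 0 0 \<eta>" and "C \<eta> = G 0 1 \<eta> - G 0 0 \<eta>"
      and "E \<eta> = G 1 1 \<eta> - G 1 0 \<eta> - G 0 1 \<eta> + G 0 0 \<eta>" for \<eta>
    have G: "G u v \<eta> = G 0 0 \<eta> + B \<eta> * u + C \<eta> * v + E \<eta> * u * v" for u v \<eta>
    proof -
      let ?x = "of_real a + of_real \<eta> * \<i>"
      let ?Y = "\<lambda>u v. (\<lambda>l. complex_of_real (y l) + of_real \<eta> * q l)(i := u, j := v)"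
      have Y: "(\<lambda>l. p u v l + of_real \<eta> * q l) = ?Y u v" for u v
        by (auto simp: p_def q_def)
      have 1: "F ?x (?Y u v) = F ?x (?Y u 0) + v * (F ?x (?Y u 1) - F ?x (?Y u 0))" for u v
        using multiaffineD[OF multiaffine, of ?x "?Y u 0" j v] by (simp add: pd_def)
      have 2: "F ?x (?Y u v) = F ?x (?Y 0 v) + u * (F ?x (?Y 1 v) - F ?x (?Y 0 v))" for u v
        using multiaffineD[OF multiaffine, of ?x "?Y 0 v" i u] False
        by (simp add: pd_def fun_upd_twist)
      show ?thesis
        unfolding B_def C_def E_def G_def Y 1[of u v] 2[of u 0] 2[of u 1] by (simp add: algebra_simps)
    qed
    have Gcont: "(G u v \<longlongrightarrow> G u v 0) (at_right 0)" for u v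
    proof -
      have "(\<lambda>t. F (of_real a + t * \<i>) (\<lambda>l. p u v l + t * q l)) holomorphic_on UNIV"
        by (rule holomorphic)
      then have "continuous_on UNIV (\<lambda>t. F (of_real a + t * \<i>) (\<lambda>l. p u v l + t * q l))"
        by (rule holomorphic_on_imp_continuous_on)
      then have "continuous_on UNIV (G u v)"
        unfolding G_def by (rule continuous_on_compose2) (auto intro!: continuous_intros)
      then have "isCont (G u v) 0" by (simp add: continuous_on_eq_continuous_at)
      then show ?thesis
        unfolding continuous_at by (rule tendsto_within_subset) auto
    qed
    define g where "g u v = ?f (y(i := u, j := v))" for u v
    have G0: "G (of_real u) (of_real v) 0 = of_real (g u v)" for u v
    proof -
      have "(\<lambda>l. p u v l + of_real 0 * q l) = p u v" for u v by simp
      then show ?thesis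
        unfolding g_def of_real_real_part_fun[symmetric] of_real_fun_upd G_def
        by (simp only: p_def) simp
    qed
    define A0 B0 C0 E0 where "A0 = g 0 0" and "B0 = g 1 0 - g 0 0" and "C0 = g 0 1 - g 0 0"
      and "E0 = g 1 1 - g 1 0 - g 0 1 + g 0 0"
    have z: "G 0 0 0 = of_real A0" "B 0 = of_real B0" "C 0 = of_real C0" "E 0 = of_real E0"
      using G0[of 0 0] G0[of 1 0] G0[of 0 1] G0[of 1 1]
      by (simp_all add: A0_def B0_def C0_def E0_def B_def C_def E_def)
    have main: "A0 * E0 \<le> B0 * C0"
    proof (rule ccontr)
      assume "\<not> A0 * E0 \<le> B0 * C0"
      then have neg: "B0 * C0 < A0 * E0" by simp
      define u where "u \<eta> = - ((G 0 0 \<eta> + C \<eta> * \<i>) / (B \<eta> + E \<eta> * \<i>))" for \<eta>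
      have BE: "B 0 + E 0 * \<i> \<noteq> 0" using neg by (auto simp: z complex_eq_iff)
      have tB: "((\<lambda>\<eta>. B \<eta> + E \<eta> * \<i>) \<longlongrightarrow> B 0 + E 0 * \<i>) (at_right 0)"
        unfolding B_def E_def by (intro tendsto_intros Gcont)
      have "(u \<longlongrightarrow> u 0) (at_right 0)"
        unfolding u_def using BE by (intro tendsto_intros tB Gcont) (auto simp: C_def intro!: tendsto_intros Gcont)
      then have "((\<lambda>\<eta>. Im (u \<eta>)) \<longlongrightarrow> Im (u 0)) (at_right 0)" by (rule tendsto_Im)
      moreover have "0 < Im (u 0)"
      proof -
        have p: "0 < B0\<^sup>2 + E0\<^sup>2" using BE by (auto simp: z complex_eq_iff sum_power2_gt_zero_iff)
        have "Im (u 0) = - ((B0 * C0 - A0 * E0) / (B0\<^sup>2 + E0\<^sup>2))"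
          by (simp add: u_def z Im_divide diff_divide_distrib[symmetric] algebra_simps)
        moreover have "(B0 * C0 - A0 * E0) / (B0\<^sup>2 + E0\<^sup>2) < 0"
          using p neg by (intro divide_neg_pos) auto
        ultimately show ?thesis by simp
      qed
      ultimately have "eventually (\<lambda>\<eta>. 0 < Im (u \<eta>)) (at_right 0)" by (rule order_tendstoD)
      moreover have "eventually (\<lambda>\<eta>. B \<eta> + E \<eta> * \<i> \<noteq> 0) (at_right 0)"
        using tB BE by (rule tendsto_imp_eventually_ne)
      moreover have "eventually (\<lambda>\<eta>::real. 0 < \<eta>) (at_right 0)"
        by (rule eventually_at_right_less)
      ultimately have "eventually (\<lambda>\<eta>. 0 < Im (u \<eta>) \<and> B \<eta> + E \<eta> * \<i> \<noteq> 0 \<and> 0 < \<eta>) (at_right 0)"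
        by eventually_elim blast
      then obtain \<eta> where \<eta>: "0 < Im (u \<eta>)" "B \<eta> + E \<eta> * \<i> \<noteq> 0" "0 < \<eta>"
        using eventually_happens'[OF trivial_limit_at_right_real] by blast
      have "G (u \<eta>) \<i> \<eta> = (G 0 0 \<eta> + C \<eta> * \<i>) + u \<eta> * (B \<eta> + E \<eta> * \<i>)"
        by (subst G) (simp add: algebra_simps)
      also have "\<dots> = 0" using \<eta>(2) by (simp add: u_def)
      finally have "G (u \<eta>) \<i> \<eta> = 0" .
      moreover have "G (u \<eta>) \<i> \<eta> \<noteq> 0"
        unfolding G_def using \<eta> False by (intro nonzero) (auto simp: p_def q_def)
      ultimately show False by simp
    qed
    have g: "g u v = A0 + B0 * u + C0 * v + E0 * u * v" for u v
    proof -
      have "complex_of_real (g u v) = of_real (A0 + B0 * u + C0 * v + E0 * u * v)"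
        unfolding G0[symmetric] G[of "of_real u" "of_real v"] z by simp
      then show ?thesis by (simp only: of_real_eq_iff)
    qed
    have "y(i := v, j := y j) = y(i := v)" for v using False by auto
    then have "?f y = g (y i) (y j)" "pd i ?f y = g 1 (y j) - g 0 (y j)" "pd j ?f y = g (y i) 1 - g (y i) 0"
      "pd i (pd j ?f) y = g 1 1 - g 1 0 - (g 0 1 - g 0 0)"
      using False by (simp_all add: g_def pd_def fun_upd_twist)
    then show ?thesis using main by (simp add: g algebra_simps)
  qed
qed

end

section \<open>Averaging over all pairs and selecting one outcome\<close>

text \<open>
The interlacing argument. Let \<open>h\<close> be the quotient of \<open>f\<close> and \<open>f + g\<close>, which is real and analytic on
\<open>[\<alpha>, \<infinity>)\<close> and positive at \<open>\<alpha>\<close> and far out. If \<open>f\<close> had a nonpositive value there, then \<open>h\<close> would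
have a minimum at an interior point, with a value \<open>\<le> 0\<close>. Not being constant, \<open>h\<close> is an open map and takes slightly
smaller real values nearby, and by minimality it does so off the real axis. But \<open>h z = - u\<close> with
\<open>u > 0\<close> means that a convex combination of \<open>f\<close> and \<open>g\<close> vanishes at \<open>z\<close>.
\<close>

lemma pencil_positive_endpoint:
  fixes f g :: "complex \<Rightarrow> complex" and \<alpha> \<beta> :: real
  assumes hol: "f holomorphic_on UNIV" "g holomorphic_on UNIV"
    and real: "\<And>x. Im (f (of_real x)) = 0" "\<And>x. Im (g (of_real x)) = 0"
    and nonzero: "\<And>z s. Im z \<noteq> 0 \<Longrightarrow> 0 \<le> s \<Longrightarrow> s \<le> 1 \<Longrightarrow> of_real s * f z + of_real (1 - s) * g z \<noteq> 0"
    and sum: "\<And>x. \<alpha> \<le> x \<Longrightarrow> 0 < Re (f (of_real x) + g (of_real x))"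
    and large: "\<And>x. \<beta> \<le> x \<Longrightarrow> 0 < Re (f (of_real x))"
    and start: "0 < Re (f (of_real \<alpha>))"
    and x: "\<alpha> \<le> x"
  shows "0 < Re (f (of_real x))"
proof (rule ccontr)
  assume neg: "\<not> 0 < Re (f (of_real x))"
  define p where "p z = f z + g z" for z
  define h where "h z = f z / p z" for z
  have fr: "f (of_real v) = of_real (Re (f (of_real v)))" for v
    using real by (simp add: complex_eq_iff)
  have pr: "p (of_real v) = of_real (Re (p (of_real v)))" for v
    using real by (simp add: complex_eq_iff p_def)
  define r where "r v = Re (f (of_real v)) / Re (p (of_real v))" for v
  have hr: "h (of_real v) = of_real (r v)" for v
    unfolding h_def r_def of_real_divide by (rule arg_cong2[OF fr pr])
  have ppos: "0 < Re (p (of_real v))" if "\<alpha> \<le> v" for v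
    using sum[OF that] by (simp add: p_def)
  have pnz: "p z \<noteq> 0" if "\<alpha> \<le> Re z" for z
  proof (cases "Im z = 0")
    case True
    then have "of_real (Re z) = z" by (simp add: complex_eq_iff)
    then show ?thesis using ppos[OF that] by auto
  next
    case False
    then show ?thesis using nonzero[of z "1/2"] by (auto simp: p_def field_simps)
  qed
  have holp: "p holomorphic_on UNIV" unfolding p_def by (intro holomorphic_intros hol)
  define b where "b = max x \<beta> + 1"
  have ab: "\<alpha> < b" "x < b" "\<beta> \<le> b" using x by (auto simp: b_def)
  have rpos: "0 < r v \<longleftrightarrow> 0 < Re (f (of_real v))" if "\<alpha> \<le> v" for v
    using ppos[OF that] by (simp add: r_def zero_less_divide_iff)
  have contr: "continuous_on {\<alpha>..b} r"
  proof -
    have "continuous_on {\<alpha>..b} (\<lambda>v. k (complex_of_real v))" if "k holomorphic_on UNIV" for k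
      by (rule continuous_on_compose2[OF holomorphic_on_imp_continuous_on[OF that]])
        (auto intro!: continuous_intros)
    from this[OF hol(1)] this[OF holp]
    have "continuous_on {\<alpha>..b} (\<lambda>v. f (complex_of_real v))" "continuous_on {\<alpha>..b} (\<lambda>v. p (complex_of_real v))" .
    moreover have "Re (p (of_real v)) \<noteq> 0" if "v \<in> {\<alpha>..b}" for v
      using ppos[of v] that by simp
    ultimately show ?thesis unfolding r_def by (intro continuous_intros) auto
  qed
  then obtain m where m: "m \<in> {\<alpha>..b}" "\<And>v. v \<in> {\<alpha>..b} \<Longrightarrow> r m \<le> r v"
    using continuous_attains_inf[of "{\<alpha>..b}" r] ab by auto
  have "r m \<le> r x" using m(2)[of x] x ab by simp
  also have "\<dots> \<le> 0" using rpos[OF x] neg by linarith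
  finally have rm: "r m \<le> 0" .
  have "m \<noteq> \<alpha>" using rm rpos[of \<alpha>] start by auto
  moreover have "m \<noteq> b" using rm rpos[of b] large[of b] ab by auto
  ultimately have m': "\<alpha> < m" "m < b" using m by auto
  define S where "S = {z. \<alpha> < Re z} \<inter> {z. Re z < b}"
  have S: "open S" "connected S"
    unfolding S_def
    by (intro open_Int open_halfspace_Re_gt open_halfspace_Re_lt)
      (intro convex_connected convex_Int convex_halfspace_Re_gt convex_halfspace_Re_lt)
  have mS: "of_real m \<in> S" using m' by (simp add: S_def)
  have holh: "h holomorphic_on S"
    unfolding h_def using pnz
    by (intro holomorphic_intros holomorphic_on_subset[OF hol(1)] holomorphic_on_subset[OF holp]) (auto simp: S_def)
  have "\<not> h constant_on S"
  proof
    assume "h constant_on S"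
    then obtain k where k: "\<And>z. z \<in> S \<Longrightarrow> h z = k" unfolding constant_on_def by blast
    have "f \<alpha> - h m * p \<alpha> = 0"
    proof (rule analytic_continuation_open[of S UNIV "\<lambda>z. f z - h m * p z" "\<lambda>_. 0"])
      show "f z - h m * p z = 0" if "z \<in> S" for z
        using k[OF that] k[OF mS] pnz[of z] that by (simp add: h_def S_def field_simps)
    qed (use S mS in \<open>auto intro!: holomorphic_intros hol holp\<close>)
    then have "h \<alpha> = h m" using pnz[of "of_real \<alpha>"] by (simp add: h_def[of "of_real \<alpha>"] field_simps)
    then have "r \<alpha> = r m" by (simp add: hr)
    then show False using rm rpos[of \<alpha>] start by simp
  qed
  then have "open (h ` S)" using open_mapping_thm[OF holh S S(1)] by blast
  moreover have "h m \<in> h ` S" using mS by blast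
  ultimately obtain e where e: "0 < e" "ball (h m) e \<subseteq> h ` S" by (meson open_contains_ball)
  have "of_real (r m - e/2) \<in> ball (h m) e" using e by (simp add: hr dist_norm)
  with e(2) have "of_real (r m - e/2) \<in> h ` S" by (rule subsetD)
  then obtain z where z: "z \<in> S" "h z = of_real (r m - e/2)" by (elim imageE) simp
  define u where "u = - (r m - e/2)"
  have u: "0 < u" using rm e by (simp add: u_def)
  show False
  proof (cases "Im z = 0")
    case True
    then have "of_real (Re z) = z" by (simp add: complex_eq_iff)
    then have "complex_of_real (r (Re z)) = of_real (r m - e/2)" using z(2) hr[of "Re z"] by simp
    then have "r (Re z) = r m - e/2" by (simp only: of_real_eq_iff)
    moreover have "r m \<le> r (Re z)" using z(1) by (intro m(2)) (auto simp: S_def)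
    ultimately show False using e by simp
  next
    case False
    have "f z = h z * p z" using pnz[of z] z(1) by (simp add: h_def S_def)
    then have "f z = - of_real u * p z" by (simp add: z(2) u_def)
    moreover have "of_real (1 + u) * f z + of_real u * g z = f z + of_real u * p z"
      by (simp add: p_def algebra_simps)
    ultimately have eq: "of_real (1 + u) * f z + of_real u * g z = 0" by simp
    \<comment> \<open>The weight \<open>w\<close> normalises the coefficients \<open>1 + u\<close> and \<open>u\<close> to a convex combination.\<close>
    define w where "w = 1 / (1 + 2 * u)"
    have w: "1 - (1 + u) * w = u * w" "0 \<le> (1 + u) * w" "(1 + u) * w \<le> 1"
      using u by (simp_all add: w_def field_simps)
    have "of_real ((1 + u) * w) * f z + of_real (1 - (1 + u) * w) * g z
        = of_real w * (of_real (1 + u) * f z + of_real u * g z)"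
      unfolding w(1) by (simp add: algebra_simps)
    then show False using nonzero[OF False w(2,3)] eq by simp
  qed
qed

text \<open>
Index \<open>i\<close> has two coordinates, \<open>(True, i)\<close> and \<open>(False, i)\<close>, one for each part of the partition.
After all steps the function is the expectation over a random partition in which \<open>i\<close> joins the
first part with probability \<open>\<theta> i\<close>, independently of the other indices.
\<close>

primrec iterated_average :: "(nat \<Rightarrow> real) \<Rightarrow> (complex \<Rightarrow> (bool \<times> nat \<Rightarrow> complex) \<Rightarrow> complex) \<Rightarrow> nat
    \<Rightarrow> complex \<Rightarrow> (bool \<times> nat \<Rightarrow> complex) \<Rightarrow> complex" where
  "iterated_average \<theta> F 0 = F"
| "iterated_average \<theta> F (Suc k) =
     pair_average (\<theta> (Suc k)) (True, Suc k) (False, Suc k) (iterated_average \<theta> F k)"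

lemma iterated_average_stable:
  assumes "stable_multiaffine V F" and "\<And>i. 0 \<le> \<theta> i \<and> \<theta> i \<le> 1"
  shows "stable_multiaffine V (iterated_average \<theta> F k)"
  by (induction k) (use assms in \<open>auto intro!: stable_multiaffine.stable_pair_average\<close>)

lemma real_part_fun_pair_average:
  assumes F: "stable_multiaffine V F"
  shows "real_part_fun (pair_average \<theta> z w F) a y =
     \<theta> * real_part_fun F a (y(z := a - 2, w := a)) + (1 - \<theta>) * real_part_fun F a (y(z := a, w := a - 2))"
proof -
  have "(\<lambda>i. complex_of_real (y i))(z := of_real a - 2, w := of_real a) = (\<lambda>i. of_real ((y(z := a - 2, w := a)) i))"
    "(\<lambda>i. complex_of_real (y i))(z := of_real a, w := of_real a - 2) = (\<lambda>i. of_real ((y(z := a, w := a - 2)) i))"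
    by auto
  then show ?thesis
    unfolding real_part_fun_def pair_average_def
    by (simp only: stable_multiaffine.of_real_real_part_fun[OF F]) simp
qed

text \<open>
Each step keeps the bound on the potentials, so the barrier \<open>c\<close> survives all of them, while every
pair of coordinates already averaged sits at \<open>c + t\<close>.
\<close>

lemma iterated_average_barrier:
  fixes c t \<Phi> :: real
  assumes F: "stable_multiaffine V F"
    and pos: "\<And>y. (\<And>i. c \<le> y i) \<Longrightarrow> 0 < real_part_fun F (c + t) y"
    and potential: "\<And>k. pd k (real_part_fun F (c + t)) (\<lambda>_. c) \<le> \<Phi> * real_part_fun F (c + t) (\<lambda>_. c)"
    and \<Phi>: "0 \<le> \<Phi>" and t: "0 < t" "1 \<le> t * (1 - 2 * \<Phi>)"
  defines "G \<equiv> \<lambda>n. real_part_fun (iterated_average (\<lambda>_. 1/2) F n) (c + t)"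
  shows "(\<forall>y. (\<forall>i. c \<le> y i) \<longrightarrow> 0 < G n y) \<and> (\<forall>k. pd k (G n) (\<lambda>_. c) \<le> \<Phi> * G n (\<lambda>_. c))"
proof (induction n)
  case 0
  have "G 0 = real_part_fun F (c + t)" by (simp add: G_def)
  then show ?case using pos potential by (simp only:) blast
next
  case (Suc n)
  have st: "stable_multiaffine V (iterated_average (\<lambda>_. 1/2) F n)"
    by (rule iterated_average_stable[OF F]) simp
  interpret rayleigh V "G n"
    unfolding G_def by (rule stable_multiaffine.rayleigh_real_part_fun[OF st])
  have eq: "G (Suc n) = (\<lambda>y. (G n (y((True, Suc n) := c + t - 2, (False, Suc n) := c + t))
      + G n (y((True, Suc n) := c + t, (False, Suc n) := c + t - 2))) / 2)"
    unfolding G_def by (rule ext) (simp add: real_part_fun_pair_average[OF st] field_simps)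
  show ?case
    unfolding eq using Suc.IH \<Phi> t
    by (intro conjI allI impI barrier_step[where \<Phi> = \<Phi>]) auto
qed

lemma iterated_average_positive:
  assumes F: "stable_multiaffine V F" and \<theta>: "\<And>i. 0 \<le> \<theta> i \<and> \<theta> i \<le> 1"
    and pos: "\<And>y. (\<And>i. 0 < y i) \<Longrightarrow> 0 < real_part_fun F a y" and a: "2 < a"
  shows "(\<And>i. 0 < y i) \<Longrightarrow> 0 < real_part_fun (iterated_average \<theta> F k) a y"
proof (induction k arbitrary: y)
  case 0
  then show ?case using pos by simp
next
  case (Suc k)
  have st: "stable_multiaffine V (iterated_average \<theta> F k)"
    by (rule iterated_average_stable[OF F \<theta>])
  let ?A = "real_part_fun (iterated_average \<theta> F k) a (y((True, Suc k) := a - 2, (False, Suc k) := a))"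
  let ?B = "real_part_fun (iterated_average \<theta> F k) a (y((True, Suc k) := a, (False, Suc k) := a - 2))"
  have "0 < ?A" "0 < ?B" using Suc.prems a by (auto intro!: Suc.IH)
  moreover have "0 \<le> \<theta> (Suc k)" "\<theta> (Suc k) \<le> 1" using \<theta> by auto
  ultimately have "0 < \<theta> (Suc k) * ?A + (1 - \<theta> (Suc k)) * ?B"
    by (cases "\<theta> (Suc k) = 0") (auto intro!: add_pos_nonneg)
  then show ?case by (simp add: real_part_fun_pair_average[OF st])
qed

lemma iterated_average_cong:
  "(\<And>i. 1 \<le> i \<Longrightarrow> i \<le> k \<Longrightarrow> \<theta> i = \<theta>' i) \<Longrightarrow> iterated_average \<theta> F k = iterated_average \<theta>' F k"
  by (induction k) auto

lemma iterated_average_affine: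
  assumes "1 \<le> j" "j \<le> k"
  shows "iterated_average (\<theta>(j := s)) F k x y =
     of_real s * iterated_average (\<theta>(j := 1)) F k x y + of_real (1 - s) * iterated_average (\<theta>(j := 0)) F k x y"
  using assms
proof (induction k arbitrary: y)
  case (Suc k)
  show ?case
  proof (cases "j = Suc k")
    case True
    have "iterated_average (\<theta>(j := v)) F k = iterated_average \<theta> F k" for v
      by (rule iterated_average_cong) (use True in auto)
    then show ?thesis unfolding True iterated_average.simps pair_average_def by simp
  next
    case False
    have IH: "iterated_average (\<theta>(j := s)) F k x y =
       of_real s * iterated_average (\<theta>(j := 1)) F k x y + of_real (1 - s) * iterated_average (\<theta>(j := 0)) F k x y" for y
      by (rule Suc.IH) (use Suc.prems False in auto)
    show ?thesis
      using False unfolding iterated_average.simps pair_average_def IH by (simp add: algebra_simps)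
  qed
qed simp

lemma iterated_average_01:
  assumes "\<And>i. \<theta> i \<in> {0, 1}"
  shows "iterated_average \<theta> F k x y = F x (\<lambda>(b, i). if 1 \<le> i \<and> i \<le> k
      then (if b = (\<theta> i = 1) then x - 2 else x) else y (b, i))"
proof (induction k arbitrary: y)
  case 0
  have "(\<lambda>(b, i). if 1 \<le> i \<and> i \<le> 0 then (if b = (\<theta> i = 1) then x - 2 else x) else y (b, i)) = y"
    by (auto simp: fun_eq_iff)
  then show ?case by (simp only: iterated_average.simps)
next
  case (Suc k)
  let ?Y = "\<lambda>k y (b, i). if 1 \<le> i \<and> i \<le> k then (if b = (\<theta> i = 1) then x - 2 else x) else y (b, i)"
  consider "\<theta> (Suc k) = 1" | "\<theta> (Suc k) = 0" using assms by blast
  then show ?case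
  proof cases
    case 1
    have "?Y k (y((True, Suc k) := x - 2, (False, Suc k) := x)) = ?Y (Suc k) y"
      using 1 by (auto simp: fun_eq_iff le_Suc_eq)
    then show ?thesis using 1 by (simp add: pair_average_def Suc.IH)
  next
    case 2
    have "?Y k (y((True, Suc k) := x, (False, Suc k) := x - 2)) = ?Y (Suc k) y"
      using 2 by (auto simp: fun_eq_iff le_Suc_eq)
    then show ?thesis using 2 by (simp add: pair_average_def Suc.IH)
  qed
qed

text \<open>
The indices are decided one after the other. With the other probabilities fixed, the average is
affine in the probability of the current index, and all members of this pencil are stable; so
positivity on \<open>[\<alpha>, \<infinity>)\<close> at \<open>1/2\<close> passes to one of the end points \<open>0\<close> and \<open>1\<close>.
\<close>

lemma exists_positive_selection:
  fixes \<alpha> :: real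
  assumes F: "stable_multiaffine V F"
    and half: "\<And>x. \<alpha> \<le> x \<Longrightarrow> 0 < real_part_fun (iterated_average (\<lambda>_. 1/2) F n) x (\<lambda>_. x)"
    and pos: "\<And>a y. (\<And>i. 0 < y i) \<Longrightarrow> 0 < real_part_fun F a y"
  shows "\<exists>\<theta>. (\<forall>i. \<theta> i \<in> {0, 1}) \<and> (\<forall>x\<ge>\<alpha>. 0 < real_part_fun (iterated_average \<theta> F n) x (\<lambda>_. x))"
proof -
  define good where "good \<theta> \<longleftrightarrow> (\<forall>x\<ge>\<alpha>. 0 < real_part_fun (iterated_average \<theta> F n) x (\<lambda>_. x))" for \<theta>
  have "\<exists>\<theta>. (\<forall>i. 1 \<le> i \<and> i \<le> m \<longrightarrow> \<theta> i \<in> {0, 1}) \<and> (\<forall>i. 0 \<le> \<theta> i \<and> \<theta> i \<le> 1) \<and> good \<theta> \<and> (\<forall>i>m. \<theta> i = 1/2)"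
    if "m \<le> n" for m
    using that
  proof (induction m)
    case 0
    show ?case using half by (intro exI[of _ "\<lambda>_. 1/2"]) (auto simp: good_def)
  next
    case (Suc m)
    then obtain \<theta> where \<theta>: "\<forall>i. 1 \<le> i \<and> i \<le> m \<longrightarrow> \<theta> i \<in> {0, 1}" "\<And>i. 0 \<le> \<theta> i \<and> \<theta> i \<le> 1" "good \<theta>"
      "\<forall>i>m. \<theta> i = 1/2" by auto
    define q where "q s x = iterated_average (\<theta>(Suc m := s)) F n x (\<lambda>_. x)" for s x
    have q: "q s x = of_real s * q 1 x + of_real (1 - s) * q 0 x" for s x
      unfolding q_def by (rule iterated_average_affine) (use Suc.prems in auto)
    have st: "stable_multiaffine V (iterated_average (\<theta>(Suc m := s)) F n)" if "0 \<le> s" "s \<le> 1" for s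
      by (rule iterated_average_stable[OF F]) (use \<theta>(2) that in auto)
    have hol: "q s holomorphic_on UNIV" if "0 \<le> s" "s \<le> 1" for s
      using stable_multiaffine.holomorphic[OF st[OF that], of 0 1 "\<lambda>_. 0" "\<lambda>_. 1"] unfolding q_def by simp
    have qcnj: "q s (cnj z) = cnj (q s z)" if "0 \<le> s" "s \<le> 1" for s z
      using stable_multiaffine.cnj[OF st[OF that], of z "\<lambda>_. z"] unfolding q_def by simp
    have qreal: "q s (of_real x) = of_real (real_part_fun (iterated_average (\<theta>(Suc m := s)) F n) x (\<lambda>_. x))"
      if "0 \<le> s" "s \<le> 1" for s x
      using stable_multiaffine.of_real_real_part_fun[OF st[OF that], of x "\<lambda>_. x"] by (simp add: q_def)
    have qnz: "q s z \<noteq> 0" if "0 \<le> s" "s \<le> 1" "Im z \<noteq> 0" for s z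
    proof (cases "0 < Im z")
      case True
      then show ?thesis unfolding q_def by (intro stable_multiaffine.nonzero[OF st[OF that(1,2)]]) auto
    next
      case False
      then have "0 < Im (cnj z)" using that by simp
      then have "q s (cnj z) \<noteq> 0" unfolding q_def by (intro stable_multiaffine.nonzero[OF st[OF that(1,2)]]) auto
      then show ?thesis using qcnj[OF that(1,2)] by auto
    qed
    \<comment> \<open>Lowering by \<open>2\<close> leaves all coordinates positive once \<open>x > 2\<close>.\<close>
    have large: "0 < Re (q s (of_real x))" if "0 \<le> s" "s \<le> 1" "3 \<le> x" for s x
      unfolding qreal[OF that(1,2)] Re_complex_of_real
      by (rule iterated_average_positive[OF F _ pos]) (use that \<theta>(2) in auto)
    have sum: "0 < Re (q 1 (of_real x) + q 0 (of_real x))" if "\<alpha> \<le> x" for x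
    proof -
      have "\<theta>(Suc m := 1/2) = \<theta>" using \<theta>(4) by auto
      then have "0 < Re (q (1/2) (of_real x))" using \<theta>(3) that by (simp add: qreal good_def)
      moreover have "q (1/2) (of_real x) = (q 1 (of_real x) + q 0 (of_real x)) / 2"
        by (subst q) (simp add: field_simps)
      ultimately show ?thesis by simp
    qed
    have "(\<forall>x\<ge>\<alpha>. 0 < Re (q 1 (of_real x))) \<or> (\<forall>x\<ge>\<alpha>. 0 < Re (q 0 (of_real x)))"
    proof (cases "0 < Re (q 1 (of_real \<alpha>))")
      case True
      have "0 < Re (q 1 (of_real x))" if "\<alpha> \<le> x" for x
      proof (rule pencil_positive_endpoint[where f = "q 1" and g = "q 0" and \<alpha> = \<alpha> and \<beta> = 3])
        show "of_real s * q 1 z + of_real (1 - s) * q 0 z \<noteq> 0" if "Im z \<noteq> 0" "0 \<le> s" "s \<le> 1" for z s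
          unfolding q[of s z, symmetric] using that by (intro qnz) auto
        show "\<alpha> \<le> x" by (rule that)
        show "0 < Re (q 1 (of_real \<alpha>))" by (rule True)
        show "0 < Re (q 1 (of_real x))" if "3 \<le> x" for x using that by (intro large) auto
        show "0 < Re (q 1 (of_real x) + q 0 (of_real x))" if "\<alpha> \<le> x" for x using that by (rule sum)
      qed (simp_all add: hol qreal[of 0] qreal[of 1])
      then show ?thesis by blast
    next
      case False
      then have st0: "0 < Re (q 0 (of_real \<alpha>))" using sum[of \<alpha>] by simp
      have "0 < Re (q 0 (of_real x))" if "\<alpha> \<le> x" for x
      proof (rule pencil_positive_endpoint[where f = "q 0" and g = "q 1" and \<alpha> = \<alpha> and \<beta> = 3])
        show "of_real s * q 0 z + of_real (1 - s) * q 1 z \<noteq> 0" if "Im z \<noteq> 0" "0 \<le> s" "s \<le> 1" for z s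
          using qnz[of "1 - s" z] q[of "1 - s" z] that by (simp add: add.commute)
        show "0 < Re (q 0 (of_real x) + q 1 (of_real x))" if "\<alpha> \<le> x" for x
          using sum[OF that] by simp
        show "\<alpha> \<le> x" by (rule that)
        show "0 < Re (q 0 (of_real \<alpha>))" by (rule st0)
        show "0 < Re (q 0 (of_real x))" if "3 \<le> x" for x using that by (intro large) auto
      qed (simp_all add: hol qreal[of 0] qreal[of 1])
      then show ?thesis by blast
    qed
    then obtain s :: real where s: "s \<in> {0, 1}" "\<forall>x\<ge>\<alpha>. 0 < Re (q s (of_real x))" by blast
    have "good (\<theta>(Suc m := s))" using s by (auto simp: good_def qreal)
    moreover have "\<forall>i. 1 \<le> i \<and> i \<le> Suc m \<longrightarrow> (\<theta>(Suc m := s)) i \<in> {0, 1}"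
      using \<theta>(1) s by (auto simp: le_Suc_eq)
    moreover have "\<forall>i. 0 \<le> (\<theta>(Suc m := s)) i \<and> (\<theta>(Suc m := s)) i \<le> 1"
      using \<theta>(2) s by auto
    moreover have "\<forall>i>Suc m. (\<theta>(Suc m := s)) i = 1/2"
      using \<theta>(4) by auto
    ultimately show ?case by blast
  qed
  then obtain \<theta> where \<theta>: "\<forall>i. 1 \<le> i \<and> i \<le> n \<longrightarrow> \<theta> i \<in> {0, 1}" "good \<theta>" by blast
  define \<theta>' where "\<theta>' i = (if \<theta> i = 1 then 1 else 0 :: real)" for i
  have "iterated_average \<theta>' F n = iterated_average \<theta> F n"
    by (rule iterated_average_cong) (use \<theta>(1) in \<open>auto simp: \<theta>'_def\<close>)
  then have "good \<theta>'" using \<theta>(2) by (simp add: good_def)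
  moreover have "\<forall>i. \<theta>' i \<in> {0, 1}" by (simp add: \<theta>'_def)
  ultimately show ?thesis unfolding good_def by blast
qed

section \<open>Determinants of weighted Gram matrices\<close>

text \<open>
A column operation with \<open>q\<close> clears the border. Expansion along the first row then shows that the
determinant of a rank-one update is affine in the size of the update.
\<close>

lemma det_bordered:
  fixes A :: "'a :: idom mat"
  assumes A: "A \<in> carrier_mat d d" and p: "p \<in> carrier_mat d 1" and q: "q \<in> carrier_mat 1 d"
  shows "det (four_block_mat (1\<^sub>m 1) (- q) p A) = det (A + p * q)"
proof -
  let ?M = "four_block_mat (1\<^sub>m 1) (- q) p A"
  let ?R = "four_block_mat (1\<^sub>m 1) q (0\<^sub>m d 1) (1\<^sub>m d)"
  have q': "- q \<in> carrier_mat 1 d" using q by simp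
  have "det ?R = 1"
    by (subst det_four_block_mat_lower_left_zero[where n = 1 and m = d]) (use q in auto)
  moreover have "?M * ?R = four_block_mat (1\<^sub>m 1) (0\<^sub>m 1 d) p (A + p * q)"
  proof -
    have "?M * ?R = four_block_mat (1\<^sub>m 1 * 1\<^sub>m 1 + - q * 0\<^sub>m d 1) (1\<^sub>m 1 * q + - q * 1\<^sub>m d)
        (p * 1\<^sub>m 1 + A * 0\<^sub>m d 1) (p * q + A * 1\<^sub>m d)"
      by (rule mult_four_block_mat[OF one_carrier_mat q' p A]) (use q in auto)
    also have "1\<^sub>m 1 * 1\<^sub>m 1 + - q * 0\<^sub>m d 1 = 1\<^sub>m 1" using q by simp
    also have "1\<^sub>m 1 * q + - q * 1\<^sub>m d = 0\<^sub>m 1 d" using q by (intro eq_matI) auto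
    also have "p * 1\<^sub>m 1 + A * 0\<^sub>m d 1 = p" using p A by simp
    also have "p * q + A * 1\<^sub>m d = A + p * q"
      using A p q by (simp add: comm_add_mat[of _ d d])
    finally show ?thesis .
  qed
  moreover have "det (?M * ?R) = det ?M * det ?R"
    by (rule det_mult[of _ "1 + d"]) (use A p q in auto)
  moreover have "det (four_block_mat (1\<^sub>m 1) (0\<^sub>m 1 d) p (A + p * q)) = det (A + p * q)"
    by (subst det_four_block_mat_upper_right_zero[where n = 1 and m = d]) (use A p q in auto)
  ultimately show ?thesis by simp
qed

lemma det_rank_one_affine:
  fixes A :: "'a :: idom mat"
  assumes A: "A \<in> carrier_mat d d" and p: "p \<in> carrier_mat d 1" and q: "q \<in> carrier_mat 1 d"
  shows "\<exists>b. \<forall>s. det (A + s \<cdot>\<^sub>m (p * q)) = det A + s * b"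
proof -
  define M where "M s = four_block_mat (1\<^sub>m 1) (- (s \<cdot>\<^sub>m q)) p A" for s
  have M: "M s \<in> carrier_mat (1 + d) (1 + d)" for s
    unfolding M_def using A by (intro four_block_carrier_mat) auto
  have row: "M s $$ (0, j) = (if j = 0 then 1 else - s * q $$ (0, j - 1))" if "j < 1 + d" for s j
    using that A q by (auto simp: M_def)
  have cof: "cofactor (M s) 0 j = cofactor (M 0) 0 j" if "j < 1 + d" for s j
  proof -
    have "mat_delete (M s) 0 j = mat_delete (M 0) 0 j"
    proof (rule eq_matI)
      fix r c assume rc: "r < dim_row (mat_delete (M 0) 0 j)" "c < dim_col (mat_delete (M 0) 0 j)"
      then have "r < d" "c < d" using M[of 0] by auto
      then have e: "mat_delete (M s) 0 j $$ (r, c) = M s $$ (Suc r, if c < j then c else Suc c)" for s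
        using M[of s] by (auto simp: mat_delete_def)
      show "mat_delete (M s) 0 j $$ (r, c) = mat_delete (M 0) 0 j $$ (r, c)"
        unfolding e using \<open>r < d\<close> \<open>c < d\<close> A p q that by (auto simp: M_def)
    qed (use M[of s] M[of 0] in auto)
    then show ?thesis by (simp add: cofactor_def)
  qed
  define b where "b = (\<Sum>j<1 + d. (if j = 0 then 0 else - q $$ (0, j - 1)) * cofactor (M 0) 0 j)"
  define a where "a = (\<Sum>j<1 + d. (if j = 0 then 1 else 0) * cofactor (M 0) 0 j)"
  have main: "det (A + s \<cdot>\<^sub>m (p * q)) = a + s * b" for s
  proof -
    have "det (A + s \<cdot>\<^sub>m (p * q)) = det (A + p * (s \<cdot>\<^sub>m q))" using p q by (simp add: mult_smult_distrib)
    also have "\<dots> = det (M s)" unfolding M_def by (rule det_bordered[symmetric]) (use A p q in auto)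
    also have "\<dots> = (\<Sum>j<1 + d. M s $$ (0, j) * cofactor (M s) 0 j)"
      by (rule laplace_expansion_row[OF M]) simp
    also have "\<dots> = (\<Sum>j<1 + d. (if j = 0 then 1 else 0) * cofactor (M 0) 0 j
        + s * ((if j = 0 then 0 else - q $$ (0, j - 1)) * cofactor (M 0) 0 j))"
      by (rule sum.cong) (auto simp: row cof[of _ s])
    also have "\<dots> = a + s * b" by (simp only: sum.distrib sum_distrib_left a_def b_def)
    finally show ?thesis .
  qed
  have "A + 0 \<cdot>\<^sub>m (p * q) = A" using A p q by auto
  then have "det A = a" using main[of 0] by simp
  then show ?thesis using main by blast
qed

text \<open>
Clearing the other border of the same matrix gives the value of the determinant.
\<close>

lemma det_scalar_plus_rank_one:
  fixes c :: "'a :: field"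
  assumes p: "p \<in> carrier_mat d 1" and q: "q \<in> carrier_mat 1 d" and c: "c \<noteq> 0"
  shows "det (c \<cdot>\<^sub>m 1\<^sub>m d + p * q) = c ^ d * (1 + (q * p) $$ (0, 0) / c)"
proof -
  let ?A = "c \<cdot>\<^sub>m 1\<^sub>m d"
  let ?M = "four_block_mat (1\<^sub>m 1) (- q) p ?A"
  let ?R = "four_block_mat (1\<^sub>m 1) (0\<^sub>m 1 d) (- (inverse c \<cdot>\<^sub>m p)) (1\<^sub>m d)"
  let ?K = "1\<^sub>m 1 + inverse c \<cdot>\<^sub>m (q * p)"
  have A: "?A \<in> carrier_mat d d" by simp
  have q': "- q \<in> carrier_mat 1 d" using q by simp
  have "det ?R = 1"
    by (subst det_four_block_mat_upper_right_zero[where n = 1 and m = d]) (use p in auto)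
  moreover have "?M * ?R = four_block_mat ?K (- q) (0\<^sub>m d 1) ?A"
  proof -
    have "?M * ?R = four_block_mat (1\<^sub>m 1 * 1\<^sub>m 1 + - q * - (inverse c \<cdot>\<^sub>m p)) (1\<^sub>m 1 * 0\<^sub>m 1 d + - q * 1\<^sub>m d)
        (p * 1\<^sub>m 1 + ?A * - (inverse c \<cdot>\<^sub>m p)) (p * 0\<^sub>m 1 d + ?A * 1\<^sub>m d)"
      by (rule mult_four_block_mat[OF one_carrier_mat q' p A]) (use p in auto)
    also have "1\<^sub>m 1 * 1\<^sub>m 1 + - q * - (inverse c \<cdot>\<^sub>m p) = ?K"
    proof -
      have "- q * - (inverse c \<cdot>\<^sub>m p) = q * (inverse c \<cdot>\<^sub>m p)"
        using p q by simp
      then show ?thesis using p q by (simp add: mult_smult_distrib)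
    qed
    also have "1\<^sub>m 1 * 0\<^sub>m 1 d + - q * 1\<^sub>m d = - q" using q by simp
    also have "p * 1\<^sub>m 1 + ?A * - (inverse c \<cdot>\<^sub>m p) = 0\<^sub>m d 1"
    proof -
      have "?A * - (inverse c \<cdot>\<^sub>m p) = c \<cdot>\<^sub>m - (inverse c \<cdot>\<^sub>m p)"
        using p by (subst mult_smult_assoc_mat[of _ d d _ 1]) auto
      then show ?thesis using p c by (intro eq_matI) auto
    qed
    also have "p * 0\<^sub>m 1 d + ?A * 1\<^sub>m d = ?A" using p by simp
    finally show ?thesis .
  qed
  moreover have "det (?M * ?R) = det ?M * det ?R"
    by (rule det_mult[of _ "1 + d"]) (use A p q in auto)
  moreover have "det (four_block_mat ?K (- q) (0\<^sub>m d 1) ?A) = det ?K * det ?A"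
    by (rule det_four_block_mat_lower_left_zero[where n = 1 and m = d]) (use p q in auto)
  moreover have "det ?K = 1 + (q * p) $$ (0, 0) / c"
    using p q by (subst det_single) (auto simp: field_simps)
  ultimately show ?thesis
    using det_bordered[OF A p q] by (simp add: mult.commute)
qed

locale isotropic_vectors =
  fixes n d :: nat and u :: "nat \<Rightarrow> real vec"
  assumes isotropic: "\<And>r c. r < d \<Longrightarrow> c < d \<Longrightarrow>
    (\<Sum>i\<in>{1..n}. u i $ r * u i $ c) = (if r = c then 1 else 0)"
begin

definition weighted_gram :: "(nat \<Rightarrow> 'a) \<Rightarrow> 'a :: real_field mat" where
  "weighted_gram z = mat d d (\<lambda>(r, c). \<Sum>i\<in>{1..n}. z i * of_real (u i $ r * u i $ c))"

definition frame_norm2 :: "nat \<Rightarrow> real" where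
  "frame_norm2 i = (\<Sum>r<d. (u i $ r)\<^sup>2)"

lemma weighted_gram_carrier [simp]: "weighted_gram z \<in> carrier_mat d d"
  by (simp add: weighted_gram_def)

lemma weighted_gram_const: "weighted_gram (\<lambda>_. a) = a \<cdot>\<^sub>m 1\<^sub>m d"
proof (rule eq_matI)
  fix r c assume rc: "r < dim_row (a \<cdot>\<^sub>m 1\<^sub>m d)" "c < dim_col (a \<cdot>\<^sub>m 1\<^sub>m d)"
  then have "weighted_gram (\<lambda>_. a) $$ (r, c) = a * of_real (\<Sum>i\<in>{1..n}. u i $ r * u i $ c)"
    by (simp add: weighted_gram_def sum_distrib_left)
  also have "(\<Sum>i\<in>{1..n}. u i $ r * u i $ c) = (if r = c then 1 else 0)"
    using rc by (intro isotropic) auto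
  finally show "weighted_gram (\<lambda>_. a) $$ (r, c) = (a \<cdot>\<^sub>m 1\<^sub>m d) $$ (r, c)"
    using rc by simp
qed (auto simp: weighted_gram_def)

text \<open>
For a kernel vector \<open>v\<close> of \<open>\<Sum>i. z i u\<^sub>i u\<^sub>i\<^sup>T\<close> the weights are \<open>w i = \<bar>u\<^sub>i\<^sup>T v\<bar>\<^sup>2\<close>: pairing the
image of \<open>v\<close> with \<open>v\<close> gives the vanishing sum, and the weights add up to the squared norm of \<open>v\<close>.
Consequently the determinant is nonzero if the \<open>z i\<close> lie in one open half plane bounded by a line
through \<open>0\<close>.
\<close>

lemma det_weighted_gram_eq_0D:
  assumes "det (weighted_gram (z :: nat \<Rightarrow> complex)) = 0"
  shows "\<exists>w. (\<forall>i. 0 \<le> w i) \<and> 0 < (\<Sum>i\<in>{1..n}. w i) \<and> (\<Sum>i\<in>{1..n}. z i * of_real (w i)) = 0"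
proof -
  obtain v where v: "v \<in> carrier_vec d" "v \<noteq> 0\<^sub>v d" "weighted_gram z *\<^sub>v v = 0\<^sub>v d"
    using assms det_0_iff_vec_prod_zero_field[OF weighted_gram_carrier] by blast
  define a where "a i = (\<Sum>c<d. of_real (u i $ c) * v $ c)" for i
  have row: "(weighted_gram z *\<^sub>v v) $ r = (\<Sum>i\<in>{1..n}. z i * of_real (u i $ r) * a i)" if "r < d" for r
  proof -
    have "(weighted_gram z *\<^sub>v v) $ r = (\<Sum>c<d. (\<Sum>i\<in>{1..n}. z i * of_real (u i $ r * u i $ c)) * v $ c)"
      using that v(1) by (simp add: weighted_gram_def scalar_prod_def atLeast0LessThan)
    also have "\<dots> = (\<Sum>c<d. \<Sum>i\<in>{1..n}. z i * of_real (u i $ r) * (of_real (u i $ c) * v $ c))"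
      by (simp add: sum_distrib_right mult.assoc)
    also have "\<dots> = (\<Sum>i\<in>{1..n}. \<Sum>c<d. z i * of_real (u i $ r) * (of_real (u i $ c) * v $ c))"
      by (rule sum.swap)
    also have "\<dots> = (\<Sum>i\<in>{1..n}. z i * of_real (u i $ r) * a i)"
      by (simp add: a_def sum_distrib_left)
    finally show ?thesis .
  qed
  have cnj_a: "cnj (a i) = (\<Sum>r<d. of_real (u i $ r) * cnj (v $ r))" for i
    by (simp add: a_def)
  have "(\<Sum>i\<in>{1..n}. z i * of_real ((cmod (a i))\<^sup>2)) = (\<Sum>i\<in>{1..n}. z i * a i * cnj (a i))"
    by (simp only: complex_norm_square mult.assoc)
  also have "\<dots> = (\<Sum>i\<in>{1..n}. \<Sum>r<d. cnj (v $ r) * (z i * of_real (u i $ r) * a i))"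
    by (simp add: cnj_a sum_distrib_left mult_ac)
  also have "\<dots> = (\<Sum>r<d. \<Sum>i\<in>{1..n}. cnj (v $ r) * (z i * of_real (u i $ r) * a i))"
    by (rule sum.swap)
  also have "\<dots> = (\<Sum>r<d. cnj (v $ r) * (weighted_gram z *\<^sub>v v) $ r)"
    by (simp add: row sum_distrib_left)
  also have "\<dots> = 0" using v(3) by simp
  finally have zero: "(\<Sum>i\<in>{1..n}. z i * of_real ((cmod (a i))\<^sup>2)) = 0" .
  have "0 < (\<Sum>i\<in>{1..n}. (cmod (a i))\<^sup>2)"
  proof (rule ccontr)
    assume "\<not> 0 < (\<Sum>i\<in>{1..n}. (cmod (a i))\<^sup>2)"
    moreover have "0 \<le> (\<Sum>i\<in>{1..n}. (cmod (a i))\<^sup>2)" by (rule sum_nonneg) simp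
    ultimately have "(\<Sum>i\<in>{1..n}. (cmod (a i))\<^sup>2) = 0" by linarith
    then have a0: "a i = 0" if "i \<in> {1..n}" for i
      using that by (subst (asm) sum_nonneg_eq_0_iff) auto
    have "v $ r = 0" if r: "r < d" for r
    proof -
      have "(\<Sum>i\<in>{1..n}. of_real (u i $ r) * a i) = (\<Sum>i\<in>{1..n}. \<Sum>c<d. of_real (u i $ r * u i $ c) * v $ c)"
        by (simp add: a_def sum_distrib_left mult.assoc)
      also have "\<dots> = (\<Sum>c<d. \<Sum>i\<in>{1..n}. of_real (u i $ r * u i $ c) * v $ c)" by (rule sum.swap)
      also have "\<dots> = (\<Sum>c<d. of_real (\<Sum>i\<in>{1..n}. u i $ r * u i $ c) * v $ c)"
        by (simp add: sum_distrib_right)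
      also have "\<dots> = (\<Sum>c<d. if r = c then v $ c else 0)"
        by (rule sum.cong) (use isotropic r in auto)
      also have "\<dots> = v $ r" using r by simp
      finally show ?thesis using a0 by simp
    qed
    then have "v = 0\<^sub>v d" using v(1) by (intro eq_vecI) auto
    then show False using v(2) by simp
  qed
  then show ?thesis using zero by (intro exI[of _ "\<lambda>i. (cmod (a i))\<^sup>2"]) auto
qed

lemma sum_pos_weights:
  fixes y w :: "nat \<Rightarrow> real"
  assumes y: "\<And>i. 0 < y i" and w: "\<forall>i. 0 \<le> w i" "0 < (\<Sum>i\<in>{1..n}. w i)"
  shows "0 < (\<Sum>i\<in>{1..n}. y i * w i)"
proof -
  have "\<exists>j\<in>{1..n}. w j \<noteq> 0"
  proof (rule ccontr)
    assume "\<not> (\<exists>j\<in>{1..n}. w j \<noteq> 0)"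
    then have "(\<Sum>i\<in>{1..n}. w i) = 0" by (intro sum.neutral) blast
    then show False using w(2) by simp
  qed
  then obtain j where j: "j \<in> {1..n}" "w j \<noteq> 0" by blast
  then have "0 < w j" using w(1) by (simp add: order_less_le)
  then have "0 < y j * w j" using y by simp
  then show ?thesis using j y w(1) by (intro sum_pos2[of _ j]) (auto simp: less_imp_le)
qed

lemma det_weighted_gram_nonzero_Im:
  assumes "\<And>i. 0 < Im (z i)"
  shows "det (weighted_gram z) \<noteq> 0"
proof
  assume "det (weighted_gram z) = 0"
  from det_weighted_gram_eq_0D[OF this] obtain w where
    w: "\<forall>i. 0 \<le> w i" "0 < (\<Sum>i\<in>{1..n}. w i)" "(\<Sum>i\<in>{1..n}. z i * of_real (w i)) = 0" by blast
  have "(\<Sum>i\<in>{1..n}. Im (z i) * w i) = 0"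
    using arg_cong[OF w(3), of Im] by simp
  then show False using sum_pos_weights[of "\<lambda>i. Im (z i)", OF assms w(1,2)] by simp
qed

lemma det_weighted_gram_of_real:
  "det (weighted_gram (\<lambda>i. complex_of_real (y i))) = of_real (det (weighted_gram y))"
proof -
  have "weighted_gram (\<lambda>i. complex_of_real (y i)) = map_mat of_real (weighted_gram y)"
    by (rule eq_matI) (auto simp: weighted_gram_def)
  then show ?thesis by (simp add: of_real_hom.hom_det)
qed

lemma det_weighted_gram_nonzero_pos:
  assumes "\<And>i. 0 < y i"
  shows "det (weighted_gram (y :: nat \<Rightarrow> real)) \<noteq> 0"
proof
  assume "det (weighted_gram y) = 0"
  then have "det (weighted_gram (\<lambda>i. complex_of_real (y i))) = 0"
    by (simp add: det_weighted_gram_of_real)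
  from det_weighted_gram_eq_0D[OF this] obtain w where
    w: "\<forall>i. 0 \<le> w i" "0 < (\<Sum>i\<in>{1..n}. w i)" "(\<Sum>i\<in>{1..n}. of_real (y i) * complex_of_real (w i)) = 0" by blast
  have "(\<Sum>i\<in>{1..n}. y i * w i) = 0"
    using arg_cong[OF w(3), of Re] by simp
  then show False using sum_pos_weights[of y, OF assms w(1,2)] by simp
qed

lemma det_weighted_gram_expand:
  "det (weighted_gram z) = (\<Sum>p\<in>{p. p permutes {0..<d}}. signof p *
     (\<Prod>r = 0..<d. \<Sum>i\<in>{1..n}. z i * of_real (u i $ r * u i $ p r)))"
proof -
  have "det (weighted_gram z) = (\<Sum>p\<in>{p. p permutes {0..<d}}. signof p * (\<Prod>r = 0..<d. weighted_gram z $$ (r, p r)))"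
    by (rule det_def') simp
  also have "\<dots> = (\<Sum>p\<in>{p. p permutes {0..<d}}. signof p *
     (\<Prod>r = 0..<d. \<Sum>i\<in>{1..n}. z i * of_real (u i $ r * u i $ p r)))"
  proof (intro sum.cong arg_cong2[where f = "(*)"] prod.cong refl)
    fix p r assume "p \<in> {p. p permutes {0..<d}}" "r \<in> {0..<d}"
    then have "r < d" "p r < d" using permutes_in_image[of p "{0..<d}" r] by auto
    then show "weighted_gram z $$ (r, p r) = (\<Sum>i\<in>{1..n}. z i * of_real (u i $ r * u i $ p r))"
      by (simp add: weighted_gram_def)
  qed
  finally show ?thesis .
qed

text \<open>
The determinant is \<open>1\<close> at the constant weight \<open>1\<close> and does not vanish on the segment from there to \<open>y\<close>.
\<close>

lemma det_weighted_gram_pos: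
  assumes y: "\<And>i. 0 < y i"
  shows "0 < det (weighted_gram (y :: nat \<Rightarrow> real))"
proof (rule ccontr)
  assume neg: "\<not> 0 < det (weighted_gram y)"
  define g where "g t = det (weighted_gram (\<lambda>i. (1 - t) + t * y i))" for t
  have "continuous_on {0..1} g"
    unfolding g_def det_weighted_gram_expand
    by (intro continuous_on_mult continuous_on_sum continuous_on_prod continuous_on_add
        continuous_on_diff continuous_on_const continuous_on_id)
  moreover have "g 0 = 1"
    by (simp add: g_def weighted_gram_const)
  moreover have "g 1 \<le> 0" using neg by (simp add: g_def)
  ultimately obtain t where t: "0 \<le> t" "t \<le> 1" "g t = 0"
    using IVT2'[of g 1 0 0] by auto
  have "0 < (1 - t) + t * y i" for i
    using t y[of i] by (cases "t = 1") (auto intro: add_pos_nonneg)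
  then show False using det_weighted_gram_nonzero_pos[of "\<lambda>i. (1 - t) + t * y i"] t(3)
    by (simp add: g_def)
qed

lemma weighted_gram_upd:
  fixes z :: "nat \<Rightarrow> 'a :: real_field"
  assumes "k \<in> {1..n}"
  shows "weighted_gram (z(k := s)) = weighted_gram (z(k := a)) + (s - a) \<cdot>\<^sub>m
     (mat d 1 (\<lambda>(r, _). of_real (u k $ r)) * mat 1 d (\<lambda>(_, c). of_real (u k $ c)))"
proof (rule eq_matI)
  fix r c
  let ?R = "weighted_gram (z(k := a)) + (s - a) \<cdot>\<^sub>m
     (mat d 1 (\<lambda>(r, _). of_real (u k $ r)) * mat 1 d (\<lambda>(_, c). of_real (u k $ c)))"
  assume "r < dim_row ?R" "c < dim_col ?R"
  then have rc: "r < d" "c < d" by auto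
  have split: "weighted_gram (z(k := b)) $$ (r, c) = b * of_real (u k $ r * u k $ c) +
      (\<Sum>i\<in>{1..n} - {k}. z i * of_real (u i $ r * u i $ c))" for b
  proof -
    have "weighted_gram (z(k := b)) $$ (r, c) = (\<Sum>i\<in>{1..n}. (z(k := b)) i * of_real (u i $ r * u i $ c))"
      using rc by (simp add: weighted_gram_def)
    also have "\<dots> = (z(k := b)) k * of_real (u k $ r * u k $ c)
        + (\<Sum>i\<in>{1..n} - {k}. (z(k := b)) i * of_real (u i $ r * u i $ c))"
      by (rule sum.remove[OF _ assms]) simp
    also have "(\<Sum>i\<in>{1..n} - {k}. (z(k := b)) i * of_real (u i $ r * u i $ c))
        = (\<Sum>i\<in>{1..n} - {k}. z i * of_real (u i $ r * u i $ c))"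
      by (rule sum.cong) auto
    finally show ?thesis by (simp only: fun_upd_same)
  qed
  show "weighted_gram (z(k := s)) $$ (r, c) = ?R $$ (r, c)"
    using rc weighted_gram_carrier[of "z(k := a)"]
    by (simp add: split scalar_prod_def) (simp add: algebra_simps)
qed (auto simp: weighted_gram_def)

lemma multiaffine_det_weighted_gram:
  "multiaffine (\<lambda>z :: nat \<Rightarrow> 'a :: real_field. det (weighted_gram z))"
  unfolding multiaffine_def
proof (intro allI)
  fix z :: "nat \<Rightarrow> 'a" and k s
  let ?f = "\<lambda>z :: nat \<Rightarrow> 'a. det (weighted_gram z)"
  show "?f (z(k := s)) = ?f (z(k := 0)) + s * pd k ?f z"
  proof (cases "k \<in> {1..n}")
    case True
    obtain b where b: "\<And>s. det (weighted_gram (z(k := 0)) + s \<cdot>\<^sub>m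
       (mat d 1 (\<lambda>(r, _). of_real (u k $ r)) * mat 1 d (\<lambda>(_, c). of_real (u k $ c)))) = ?f (z(k := 0)) + s * b"
      using det_rank_one_affine[OF weighted_gram_carrier, of "mat d 1 (\<lambda>(r, _). of_real (u k $ r))"
          "mat 1 d (\<lambda>(_, c). of_real (u k $ c))" "z(k := 0)"] by auto
    have "?f (z(k := s)) = ?f (z(k := 0)) + s * b" for s
      using b[of s] weighted_gram_upd[OF True, of z s 0] by simp
    from this[of s] this[of 1] show ?thesis by (simp add: pd_def)
  next
    case False
    then have "weighted_gram (z(k := v)) = weighted_gram z" for v
      unfolding weighted_gram_def by (intro cong_mat refl) (auto intro!: sum.cong)
    then show ?thesis by (simp add: pd_def)
  qed
qed

lemma pd_det_weighted_gram_const: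
  assumes "k \<in> {1..n}" and c: "c \<noteq> (0::real)"
  shows "pd k (\<lambda>z. det (weighted_gram z)) (\<lambda>_. c) = frame_norm2 k / c * det (weighted_gram (\<lambda>_. c))"
proof -
  let ?f = "\<lambda>z :: nat \<Rightarrow> real. det (weighted_gram z)"
  let ?p = "mat d 1 (\<lambda>(r, _). u k $ r)" and ?q = "mat 1 d (\<lambda>(_, c). u k $ c)"
  have "?f ((\<lambda>_. c)(k := c + 1)) = det (c \<cdot>\<^sub>m 1\<^sub>m d + ?p * ?q)"
  proof -
    have "(\<lambda>_. c)(k := c) = (\<lambda>_. c)" by auto
    moreover have "1 \<cdot>\<^sub>m (?p * ?q) = ?p * ?q" by (intro eq_matI) auto
    ultimately show ?thesis
      using weighted_gram_upd[OF assms(1), of "\<lambda>_. c" "c + 1" c] by (simp add: weighted_gram_const)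
  qed
  also have "\<dots> = c ^ d * (1 + (?q * ?p) $$ (0, 0) / c)"
    by (rule det_scalar_plus_rank_one) (use c in auto)
  also have "(?q * ?p) $$ (0, 0) = frame_norm2 k"
    by (simp add: frame_norm2_def scalar_prod_def atLeast0LessThan power2_eq_square)
  finally have "?f ((\<lambda>_. c)(k := c + 1)) = c ^ d * (1 + frame_norm2 k / c)" .
  moreover have "?f ((\<lambda>_. c)(k := c + 1)) = ?f (\<lambda>_. c) + 1 * pd k ?f (\<lambda>_. c)"
    using multiaffine_shift[OF multiaffine_det_weighted_gram, of "\<lambda>_. c" k 1] by simp
  moreover have "?f (\<lambda>_. c) = c ^ d" by (simp add: weighted_gram_const)
  ultimately show ?thesis by (simp add: algebra_simps)
qed

text \<open>
With both coordinates of each index equal to \<open>x\<close>, apart from the one that its part selects, which is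
\<open>x - 2\<close>, this is the product of the characteristic polynomials of twice the two partial sums.
\<close>

definition paired_det :: "complex \<Rightarrow> (bool \<times> nat \<Rightarrow> complex) \<Rightarrow> complex" where
  "paired_det x y = det (weighted_gram (\<lambda>i. y (True, i))) * det (weighted_gram (\<lambda>i. y (False, i)))"

lemma stable_paired_det: "stable_multiaffine (UNIV \<times> {1..n}) paired_det"
proof
  show "finite ((UNIV :: bool set) \<times> {1..n})" by simp
next
  fix x and y y' :: "bool \<times> nat \<Rightarrow> complex"
  assume e: "\<And>i. i \<in> UNIV \<times> {1..n} \<Longrightarrow> y i = y' i"
  have "weighted_gram (\<lambda>i. y (b, i)) = weighted_gram (\<lambda>i. y' (b, i))" for b
    unfolding weighted_gram_def by (intro cong_mat refl) (auto intro!: sum.cong simp: e)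
  then show "paired_det x y = paired_det x y'" by (simp add: paired_det_def)
next
  fix x
  show "multiaffine (paired_det x)"
    unfolding multiaffine_def
  proof (intro allI)
    fix y :: "bool \<times> nat \<Rightarrow> complex" and bk :: "bool \<times> nat" and s
    obtain b k where bk: "bk = (b, k)" by force
    note ma = multiaffineD[OF multiaffine_det_weighted_gram, unfolded pd_def]
    show "paired_det x (y(bk := s)) = paired_det x (y(bk := 0)) + s * pd bk (paired_det x) y"
    proof (cases b)
      case True
      have "(\<lambda>i. (y((True, k) := v)) (True, i)) = (\<lambda>i. y (True, i))(k := v)"
        "(\<lambda>i. (y((True, k) := v)) (False, i)) = (\<lambda>i. y (False, i))" for v by auto
      note upd = this
      have bk: "bk = (True, k)" using bk True by simp
      show ?thesis
        unfolding pd_def paired_det_def bk upd ma[of "\<lambda>i. y (True, i)" k s] by (simp only: algebra_simps)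
    next
      case False
      have "(\<lambda>i. (y((False, k) := v)) (False, i)) = (\<lambda>i. y (False, i))(k := v)"
        "(\<lambda>i. (y((False, k) := v)) (True, i)) = (\<lambda>i. y (True, i))" for v by auto
      note upd = this
      have bk: "bk = (False, k)" using bk False by simp
      show ?thesis
        unfolding pd_def paired_det_def bk upd ma[of "\<lambda>i. y (False, i)" k s] by (simp only: algebra_simps)
    qed
  qed
next
  fix x and y :: "bool \<times> nat \<Rightarrow> complex"
  assume "\<And>i. 0 < Im (y i)"
  then show "paired_det x y \<noteq> 0"
    by (simp add: paired_det_def det_weighted_gram_nonzero_Im)
next
  fix x and y :: "bool \<times> nat \<Rightarrow> complex"
  interpret cnj_hom: comm_ring_hom cnj by unfold_locales auto
  have "det (weighted_gram (\<lambda>i. cnj (z i))) = cnj (det (weighted_gram z))" for z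
  proof -
    have "weighted_gram (\<lambda>i. cnj (z i)) = map_mat cnj (weighted_gram z)"
      by (rule eq_matI) (auto simp: weighted_gram_def)
    then show ?thesis by (simp add: cnj_hom.hom_det)
  qed
  then show "paired_det (cnj x) (\<lambda>i. cnj (y i)) = cnj (paired_det x y)"
    by (simp add: paired_det_def)
next
  fix a b and p q :: "bool \<times> nat \<Rightarrow> complex"
  show "(\<lambda>t. paired_det (a + t * b) (\<lambda>i. p i + t * q i)) holomorphic_on UNIV"
    unfolding paired_det_def det_weighted_gram_expand
    by (intro holomorphic_on_mult holomorphic_on_sum holomorphic_on_prod holomorphic_on_add
        holomorphic_on_const holomorphic_on_ident)
qed

lemma real_part_paired_det:
  "real_part_fun paired_det a y =
     det (weighted_gram (\<lambda>i. y (True, i))) * det (weighted_gram (\<lambda>i. y (False, i)))"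
  unfolding real_part_fun_def paired_det_def
  by (simp add: det_weighted_gram_of_real)

end

context isotropic_vectors begin

text \<open>
The choice of constants: at the barrier \<open>c = 4 \<surd>\<epsilon>\<close> all potentials are at most
\<open>\<epsilon> / c = \<surd>\<epsilon> / 4\<close>, and \<open>t = 1 + \<surd>\<epsilon>\<close> satisfies \<open>t (1 - \<surd>\<epsilon> / 2) \<ge> 1\<close> because
\<open>\<epsilon> \<le> 1\<close>. The averaged coordinates end at \<open>c + t = 1 + 5 \<surd>\<epsilon>\<close>, and any larger \<open>x\<close> allows a
larger \<open>t\<close>.
\<close>

lemma det_half_average_positive:
  fixes \<epsilon> x :: real
  assumes \<epsilon>: "0 < \<epsilon>" "\<epsilon> \<le> 1" and small: "\<And>i. i \<in> {1..n} \<Longrightarrow> frame_norm2 i \<le> \<epsilon>"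
    and x: "1 + 5 * sqrt \<epsilon> \<le> x"
  shows "0 < real_part_fun (iterated_average (\<lambda>_. 1/2) paired_det n) x (\<lambda>_. x)"
proof -
  define s where "s = sqrt \<epsilon>"
  have s: "0 < s" "s \<le> 1" "\<epsilon> = s * s" using \<epsilon> by (auto simp: s_def)
  define c where "c = 4 * s"
  define t where "t = x - c"
  define \<Phi> where "\<Phi> = s / 4"
  have c: "0 < c" using s by (simp add: c_def)
  have \<Phi>: "\<epsilon> / c = \<Phi>" using s by (simp add: c_def \<Phi>_def)
  have t: "1 + s \<le> t" using x by (simp add: t_def c_def s_def)
  have pos: "0 < det (weighted_gram y)" if "\<And>i. c \<le> y i" for y
    using that c by (intro det_weighted_gram_pos) (meson less_le_trans)
  have "(\<forall>y. (\<forall>i. c \<le> y i) \<longrightarrow> 0 < real_part_fun (iterated_average (\<lambda>_. 1/2) paired_det n) (c + t) y) \<and>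
     (\<forall>k. pd k (real_part_fun (iterated_average (\<lambda>_. 1/2) paired_det n) (c + t)) (\<lambda>_. c)
        \<le> \<Phi> * real_part_fun (iterated_average (\<lambda>_. 1/2) paired_det n) (c + t) (\<lambda>_. c))"
  proof (rule iterated_average_barrier[OF stable_paired_det])
    show "0 < real_part_fun paired_det (c + t) y" if "\<And>i. c \<le> y i" for y
      unfolding real_part_paired_det using that by (intro mult_pos_pos pos) auto
    show "0 \<le> \<Phi>" using s by (simp add: \<Phi>_def)
    show "0 < t" using t s by simp
    have "1 * (1 - s * s) \<ge> 0" using s mult_le_one[of s s] by simp
    then have "1 \<le> (1 + s) * (1 - 2 * \<Phi>)"
      using s mult_left_mono[of s 1 s] by (simp add: \<Phi>_def algebra_simps)
    also have "\<dots> \<le> t * (1 - 2 * \<Phi>)" using t s by (intro mult_right_mono) (auto simp: \<Phi>_def)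
    finally show "1 \<le> t * (1 - 2 * \<Phi>)" .
    fix bk :: "bool \<times> nat"
    obtain b k where bk: "bk = (b, k)" by force
    let ?f = "\<lambda>z :: nat \<Rightarrow> real. det (weighted_gram z)"
    let ?D = "?f (\<lambda>_. c)"
    have D: "0 < ?D" by (rule pos) simp
    have "real_part_fun paired_det (c + t) ((\<lambda>_. c)((b, k) := v)) = ?f ((\<lambda>_. c)(k := v)) * ?D" for v
    proof (cases b)
      case True
      have "(\<lambda>i. ((\<lambda>_. c)((True, k) := v)) (True, i)) = (\<lambda>_. c)(k := v)"
        "(\<lambda>i. ((\<lambda>_. c)((True, k) := v)) (False, i)) = (\<lambda>_. c)" by auto
      then show ?thesis unfolding real_part_paired_det using True by (simp only: simp_thms)
    next
      case False
      have "(\<lambda>i. ((\<lambda>_. c)((False, k) := v)) (False, i)) = (\<lambda>_. c)(k := v)"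
        "(\<lambda>i. ((\<lambda>_. c)((False, k) := v)) (True, i)) = (\<lambda>_. c)" by auto
      then show ?thesis unfolding real_part_paired_det using False by (simp only: simp_thms mult.commute)
    qed
    then have pd: "pd bk (real_part_fun paired_det (c + t)) (\<lambda>_. c) = pd k ?f (\<lambda>_. c) * ?D"
      unfolding pd_def bk by (simp only: left_diff_distrib)
    have "pd k ?f (\<lambda>_. c) \<le> \<Phi> * ?D"
    proof (cases "k \<in> {1..n}")
      case True
      have "frame_norm2 k / c \<le> \<Phi>" unfolding \<Phi>[symmetric] using small[OF True] c by (intro divide_right_mono) auto
      then have "frame_norm2 k / c * ?D \<le> \<Phi> * ?D" using D by (intro mult_right_mono) auto
      moreover have "pd k ?f (\<lambda>_. c) = frame_norm2 k / c * ?D"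
        by (rule pd_det_weighted_gram_const[OF True]) (use c in simp)
      ultimately show ?thesis by simp
    next
      case False
      then have "weighted_gram ((\<lambda>_. c)(k := v)) = weighted_gram (\<lambda>_. c)" for v
        unfolding weighted_gram_def by (intro cong_mat refl) (auto intro!: sum.cong)
      then have "pd k ?f (\<lambda>_. c) = 0" by (simp add: pd_def)
      then show ?thesis using D s by (simp add: \<Phi>_def)
    qed
    then have "pd k ?f (\<lambda>_. c) * ?D \<le> \<Phi> * ?D * ?D" using D by (intro mult_right_mono) auto
    then show "pd bk (real_part_fun paired_det (c + t)) (\<lambda>_. c) \<le> \<Phi> * real_part_fun paired_det (c + t) (\<lambda>_. c)"
      unfolding pd real_part_paired_det by (simp only: mult.assoc)
  qed
  moreover have "c + t = x" by (simp add: t_def)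
  moreover have "c \<le> x" using t s by (simp add: t_def)
  ultimately show ?thesis by simp
qed

lemma exists_subset_det_nonzero:
  fixes \<epsilon> :: real
  assumes \<epsilon>: "0 < \<epsilon>" "\<epsilon> \<le> 1" and small: "\<And>i. i \<in> {1..n} \<Longrightarrow> frame_norm2 i \<le> \<epsilon>"
  shows "\<exists>S \<subseteq> {1..n}. \<forall>x \<ge> 1 + 5 * sqrt \<epsilon>.
    det (weighted_gram (\<lambda>i. if i \<in> S then x - 2 else x)) \<noteq> 0 \<and>
    det (weighted_gram (\<lambda>i. if i \<in> {1..n} - S then x - 2 else x)) \<noteq> 0"
proof -
  have "\<exists>\<theta>. (\<forall>i. \<theta> i \<in> {0, 1}) \<and>
      (\<forall>x\<ge>1 + 5 * sqrt \<epsilon>. 0 < real_part_fun (iterated_average \<theta> paired_det n) x (\<lambda>_. x))"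
  proof (rule exists_positive_selection[OF stable_paired_det])
    show "0 < real_part_fun (iterated_average (\<lambda>_. 1/2) paired_det n) x (\<lambda>_. x)" if "1 + 5 * sqrt \<epsilon> \<le> x" for x
      by (rule det_half_average_positive[OF \<epsilon> small that])
    show "0 < real_part_fun paired_det a y" if "\<And>i. 0 < y i" for a y
      unfolding real_part_paired_det using that by (intro mult_pos_pos det_weighted_gram_pos) auto
  qed
  then obtain \<theta> where \<theta>: "\<And>i. \<theta> i \<in> {0, 1}"
    "\<And>x. 1 + 5 * sqrt \<epsilon> \<le> x \<Longrightarrow> 0 < real_part_fun (iterated_average \<theta> paired_det n) x (\<lambda>_. x)" by blast
  define S where "S = {i \<in> {1..n}. \<theta> i = 1}"
  show ?thesis
  proof (intro exI[of _ S] conjI allI impI)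
    show "S \<subseteq> {1..n}" by (auto simp: S_def)
    fix x assume x: "1 + 5 * sqrt \<epsilon> \<le> x"
    let ?zS = "\<lambda>i. if i \<in> S then x - 2 else x"
    let ?zT = "\<lambda>i. if i \<in> {1..n} - S then x - 2 else x"
    have "iterated_average \<theta> paired_det n (of_real x) (\<lambda>_. of_real x)
      = paired_det (of_real x) (\<lambda>(b, i). complex_of_real (if b then ?zS i else ?zT i))"
      unfolding iterated_average_01[OF \<theta>(1)]
      by (rule arg_cong[where f = "paired_det (of_real x)"]) (auto simp: fun_eq_iff S_def)
    also have "\<dots> = of_real (det (weighted_gram ?zS) * det (weighted_gram ?zT))"
      unfolding paired_det_def by (simp only: prod.case if_True if_False det_weighted_gram_of_real of_real_mult)
    finally have "0 < det (weighted_gram ?zS) * det (weighted_gram ?zT)"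
      using \<theta>(2)[OF x] by (simp add: real_part_fun_def)
    then show "det (weighted_gram ?zS) \<noteq> 0" "det (weighted_gram ?zT) \<noteq> 0" by auto
  qed
qed

end

section \<open>From nonsingular shifts to norm bounds\<close>

lemma symmetric_form_expand:
  fixes B :: "real mat"
  assumes B: "B \<in> carrier_mat d d" and sym: "transpose_mat B = B"
    and w: "w \<in> carrier_vec d" and v: "v \<in> carrier_vec d"
  shows "(w - k \<cdot>\<^sub>v v) \<bullet> (B *\<^sub>v (w - k \<cdot>\<^sub>v v)) = w \<bullet> (B *\<^sub>v w) - 2 * k * (v \<bullet> (B *\<^sub>v w)) + k\<^sup>2 * (v \<bullet> (B *\<^sub>v v))"
proof -
  have swap: "w \<bullet> (B *\<^sub>v v) = v \<bullet> (B *\<^sub>v w)"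
    using transpose_vec_mult_scalar[OF B v w] sym B v w
    by (metis comm_scalar_prod mult_mat_vec_carrier)
  have c: "B *\<^sub>v v \<in> carrier_vec d" "B *\<^sub>v w \<in> carrier_vec d" "k \<cdot>\<^sub>v v \<in> carrier_vec d"
    using B v w by auto
  have "B *\<^sub>v (w - k \<cdot>\<^sub>v v) = B *\<^sub>v w - k \<cdot>\<^sub>v (B *\<^sub>v v)"
    using B v w by (simp add: mult_minus_distrib_mat_vec mult_mat_vec)
  then show ?thesis
    using B v w c swap
    by (simp add: minus_scalar_prod_distrib[of _ d] scalar_prod_minus_distrib[of _ d]
        smult_scalar_prod_distrib[of _ d] scalar_prod_smult_distrib[of _ d]
        algebra_simps power2_eq_square)
qed

lemma smult_mat_mult_vec:
  fixes A :: "real mat"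
  assumes "A \<in> carrier_mat d d" "v \<in> carrier_vec d"
  shows "(x \<cdot>\<^sub>m A) *\<^sub>v v = x \<cdot>\<^sub>v (A *\<^sub>v v)"
  using assms by (intro eq_vecI) (auto simp: scalar_prod_def sum_distrib_left mult.assoc)

lemma shifted_form:
  fixes A :: "real mat"
  assumes A: "A \<in> carrier_mat d d" and v: "v \<in> carrier_vec d"
  shows "v \<bullet> ((x \<cdot>\<^sub>m 1\<^sub>m d - A) *\<^sub>v v) = x * (v \<bullet> v) - v \<bullet> (A *\<^sub>v v)"
proof -
  have "(x \<cdot>\<^sub>m 1\<^sub>m d - A) *\<^sub>v v = x \<cdot>\<^sub>v v - A *\<^sub>v v"
    using A v by (simp add: minus_mult_distrib_mat_vec[of _ d d] smult_mat_mult_vec[of _ d])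
  then show ?thesis
    using A v by (simp add: scalar_prod_minus_distrib[of _ d] scalar_prod_smult_distrib[of _ d])
qed

lemma form_bounded:
  fixes W :: "real mat"
  assumes W: "W \<in> carrier_mat d d"
  shows "\<exists>C>0. \<forall>v \<in> carrier_vec d. v \<bullet> (W *\<^sub>v v) \<le> C * (v \<bullet> v)"
proof -
  define C where "C = (\<Sum>r<d. \<Sum>c<d. \<bar>W $$ (r, c)\<bar>) + 1"
  have C: "0 < C" unfolding C_def by (intro add_nonneg_pos sum_nonneg) auto
  have "v \<bullet> (W *\<^sub>v v) \<le> C * (v \<bullet> v)" if v: "v \<in> carrier_vec d" for v
  proof -
    have vv: "v \<bullet> v = (\<Sum>c<d. (v $ c)\<^sup>2)"
      using v by (simp add: scalar_prod_def atLeast0LessThan power2_eq_square)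
    have vv0: "0 \<le> v \<bullet> v" unfolding vv by (rule sum_nonneg) simp
    have le: "(v $ c)\<^sup>2 \<le> v \<bullet> v" if "c < d" for c
      unfolding vv using that by (intro member_le_sum) auto
    have prod: "\<bar>v $ r * v $ c\<bar> \<le> v \<bullet> v" if "r < d" "c < d" for r c
    proof -
      have "2 * (v $ r * v $ c) \<le> (v $ r)\<^sup>2 + (v $ c)\<^sup>2" "- 2 * (v $ r * v $ c) \<le> (v $ r)\<^sup>2 + (v $ c)\<^sup>2"
        using zero_le_power2[of "v $ r - v $ c"] zero_le_power2[of "v $ r + v $ c"]
        by (simp_all add: power2_eq_square algebra_simps)
      then show ?thesis using le[OF that(1)] le[OF that(2)] by linarith
    qed
    have "v \<bullet> (W *\<^sub>v v) = (\<Sum>r<d. \<Sum>c<d. W $$ (r, c) * (v $ r * v $ c))"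
      using v W by (simp add: scalar_prod_def atLeast0LessThan sum_distrib_left mult_ac)
    also have "\<dots> \<le> (\<Sum>r<d. \<Sum>c<d. \<bar>W $$ (r, c)\<bar> * (v \<bullet> v))"
    proof (intro sum_mono)
      fix r c assume "r \<in> {..<d}" "c \<in> {..<d}"
      then have "\<bar>W $$ (r, c)\<bar> * \<bar>v $ r * v $ c\<bar> \<le> \<bar>W $$ (r, c)\<bar> * (v \<bullet> v)"
        by (intro mult_left_mono prod) auto
      then show "W $$ (r, c) * (v $ r * v $ c) \<le> \<bar>W $$ (r, c)\<bar> * (v \<bullet> v)"
        unfolding abs_mult[symmetric] by (rule order_trans[OF abs_ge_self])
    qed
    also have "\<dots> = (C - 1) * (v \<bullet> v)" by (simp add: C_def sum_distrib_right)
    also have "\<dots> \<le> C * (v \<bullet> v)" using vv0 by (simp add: algebra_simps)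
    finally show ?thesis .
  qed
  then show ?thesis using C by blast
qed

lemma scalar_prod_self_nonneg: "0 \<le> (v :: real vec) \<bullet> v"
  by (simp add: scalar_prod_def sum_nonneg)

text \<open>
A bound on all eigenvalues of a symmetric matrix bounds its quadratic form. Let \<open>m\<close> be the least
number with \<open>v \<bullet> A v \<le> m (v \<bullet> v)\<close> for all \<open>v\<close>, and suppose \<open>m \<ge> \<alpha>\<close>. Then
\<open>B = m I - A\<close> is positive semidefinite and has an inverse \<open>W\<close>. Its form at \<open>W v - C v\<close> is
nonnegative; for a bound \<open>C\<close> on the form of \<open>W\<close> this yields \<open>v \<bullet> v \<le> C (v \<bullet> B v)\<close>, so that
\<open>m - 1 / C\<close> would do as well.
\<close>

lemma form_le_of_nonsingular:
  fixes A :: "real mat" and \<alpha> :: real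
  assumes A: "A \<in> carrier_mat d d" and sym: "transpose_mat A = A"
    and nonsing: "\<And>x. \<alpha> \<le> x \<Longrightarrow> det (x \<cdot>\<^sub>m 1\<^sub>m d - A) \<noteq> 0"
    and v: "v \<in> carrier_vec d"
  shows "v \<bullet> (A *\<^sub>v v) \<le> \<alpha> * (v \<bullet> v)"
proof -
  define X where "X = {x. \<forall>v \<in> carrier_vec d. v \<bullet> (A *\<^sub>v v) \<le> x * (v \<bullet> v)}"
  obtain C0 where C0: "C0 \<in> X" using form_bounded[OF A] unfolding X_def by blast
  have up: "y \<in> X" if "x \<in> X" "x \<le> y" for x y
    unfolding X_def
  proof (intro CollectI ballI)
    fix v :: "real vec" assume "v \<in> carrier_vec d"
    then have "v \<bullet> (A *\<^sub>v v) \<le> x * (v \<bullet> v)" using that by (simp add: X_def)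
    also have "\<dots> \<le> y * (v \<bullet> v)" using that by (intro mult_right_mono scalar_prod_self_nonneg)
    finally show "v \<bullet> (A *\<^sub>v v) \<le> y * (v \<bullet> v)" .
  qed
  have "\<alpha> \<in> X"
  proof (rule ccontr)
    assume no: "\<alpha> \<notin> X"
    have lower: "\<alpha> \<le> x" if "x \<in> X" for x using up[OF that, of \<alpha>] no by linarith
    define m where "m = Inf X"
    have bdd: "bdd_below X" using lower by (intro bdd_belowI) auto
    have m: "\<alpha> \<le> m" unfolding m_def using C0 lower by (intro cInf_greatest) auto
    have mX: "v \<bullet> (A *\<^sub>v v) \<le> m * (v \<bullet> v)" if v: "v \<in> carrier_vec d" for v
    proof (cases "v \<bullet> v = 0")
      case True
      then show ?thesis using C0 v by (force simp: X_def)
    next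
      case False
      then have vv: "0 < v \<bullet> v" using scalar_prod_self_nonneg[of v] by simp
      have "(v \<bullet> (A *\<^sub>v v)) / (v \<bullet> v) \<le> m"
        unfolding m_def using C0 v vv by (intro cInf_greatest) (auto simp: X_def field_simps)
      then show ?thesis using vv by (simp add: field_simps)
    qed
    define B where "B = m \<cdot>\<^sub>m 1\<^sub>m d - A"
    have B: "B \<in> carrier_mat d d" unfolding B_def using A by (rule minus_carrier_mat)
    have symB: "transpose_mat B = B"
    proof (rule eq_matI)
      fix i j assume "i < dim_row B" "j < dim_col B"
      then have ij: "i < d" "j < d" using B by auto
      have "A $$ (j, i) = A $$ (i, j)"
        using ij A arg_cong[OF sym, of "\<lambda>M. M $$ (i, j)"] by simp
      then show "transpose_mat B $$ (i, j) = B $$ (i, j)"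
        using ij A by (simp add: B_def)
    qed (use B in auto)
    have dB: "det B \<noteq> 0" unfolding B_def by (rule nonsing[OF m])
    define W where "W = inverse (det B) \<cdot>\<^sub>m adj_mat B"
    have W: "W \<in> carrier_mat d d" using adj_mat(1)[OF B] by (simp add: W_def)
    have BW: "B * W = 1\<^sub>m d"
    proof -
      have "B * W = inverse (det B) \<cdot>\<^sub>m (B * adj_mat B)"
        unfolding W_def using B adj_mat(1)[OF B] by (simp add: mult_smult_distrib)
      also have "\<dots> = inverse (det B) \<cdot>\<^sub>m (det B \<cdot>\<^sub>m 1\<^sub>m d)" using adj_mat(2)[OF B] by simp
      also have "\<dots> = 1\<^sub>m d" using dB by (intro eq_matI) auto
      finally show ?thesis .
    qed
    obtain C where C: "0 < C" "\<And>v. v \<in> carrier_vec d \<Longrightarrow> v \<bullet> (W *\<^sub>v v) \<le> C * (v \<bullet> v)"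
      using form_bounded[OF W] by blast
    have "m - 1 / C \<in> X"
      unfolding X_def
    proof (intro CollectI ballI)
      fix v :: "real vec" assume v: "v \<in> carrier_vec d"
      define w where "w = W *\<^sub>v v"
      have w: "w \<in> carrier_vec d" using W v by (simp add: w_def)
      have Bw: "B *\<^sub>v w = v"
        unfolding w_def using B W v BW by (simp add: assoc_mult_mat_vec[symmetric, of _ d d _ d])
      have form: "y \<bullet> (B *\<^sub>v y) = m * (y \<bullet> y) - y \<bullet> (A *\<^sub>v y)" if "y \<in> carrier_vec d" for y
        unfolding B_def by (rule shifted_form[OF A that])
      have "w - C \<cdot>\<^sub>v v \<in> carrier_vec d" using w v by simp
      then have "0 \<le> (w - C \<cdot>\<^sub>v v) \<bullet> (B *\<^sub>v (w - C \<cdot>\<^sub>v v))"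
        using mX by (simp add: form)
      also have "\<dots> = w \<bullet> v - 2 * C * (v \<bullet> v) + C\<^sup>2 * (v \<bullet> (B *\<^sub>v v))"
        unfolding symmetric_form_expand[OF B symB w v] Bw ..
      also have "w \<bullet> v = v \<bullet> (W *\<^sub>v v)" unfolding w_def using W v by (intro comm_scalar_prod[of _ d]) auto
      also have "v \<bullet> (W *\<^sub>v v) - 2 * C * (v \<bullet> v) + C\<^sup>2 * (v \<bullet> (B *\<^sub>v v))
          \<le> C * (v \<bullet> v) - 2 * C * (v \<bullet> v) + C\<^sup>2 * (v \<bullet> (B *\<^sub>v v))" using C(2)[OF v] by simp
      also have "\<dots> = C * (C * (v \<bullet> (B *\<^sub>v v)) - v \<bullet> v)" by (simp add: algebra_simps power2_eq_square)
      finally have "v \<bullet> v \<le> C * (v \<bullet> (B *\<^sub>v v))" using C(1) by (simp add: zero_le_mult_iff)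
      then have "(v \<bullet> v) / C \<le> v \<bullet> (B *\<^sub>v v)" using C(1) by (simp add: field_simps)
      then show "v \<bullet> (A *\<^sub>v v) \<le> (m - 1 / C) * (v \<bullet> v)"
        by (simp add: form[OF v] algebra_simps)
    qed
    then have "m \<le> m - 1 / C" unfolding m_def using bdd by (intro cInf_lower)
    then show False using C(1) by simp
  qed
  then show ?thesis using v by (simp add: X_def)
qed

text \<open>
Polarisation: for \<open>w = M v\<close>, the values of the form at \<open>w + \<kappa> v\<close> and at \<open>w - \<kappa> v\<close> differ by
\<open>4 \<kappa> (w \<bullet> w)\<close>, while the assumed bounds allow a difference of only
\<open>2 \<kappa> (w \<bullet> w) + 2 \<kappa>\<^sup>3 (v \<bullet> v)\<close>.
\<close>

lemma mat_opnorm_le_of_form_bound: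
  fixes M :: "real mat"
  assumes M: "M \<in> carrier_mat d d" and sym: "transpose_mat M = M" and \<kappa>: "0 < \<kappa>"
    and upper: "\<And>v. v \<in> carrier_vec d \<Longrightarrow> v \<bullet> (M *\<^sub>v v) \<le> \<kappa> * (v \<bullet> v)"
    and lower: "\<And>v. v \<in> carrier_vec d \<Longrightarrow> - \<kappa> * (v \<bullet> v) \<le> v \<bullet> (M *\<^sub>v v)"
  shows "mat_opnorm M \<le> \<kappa>"
  unfolding mat_opnorm_def
proof (rule cSup_least)
  have "vec_norm2 (M *\<^sub>v 0\<^sub>v d) \<in> {vec_norm2 (M *\<^sub>v x) |x. x \<in> carrier_vec (dim_col M) \<and> vec_norm2 x \<le> 1}"
    using M by (auto intro!: exI[of _ "0\<^sub>v d"] simp: vec_norm2_def)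
  then show "{vec_norm2 (M *\<^sub>v x) |x. x \<in> carrier_vec (dim_col M) \<and> vec_norm2 x \<le> 1} \<noteq> {}" by blast
next
  fix r assume "r \<in> {vec_norm2 (M *\<^sub>v x) |x. x \<in> carrier_vec (dim_col M) \<and> vec_norm2 x \<le> 1}"
  then obtain v where v: "v \<in> carrier_vec d" "vec_norm2 v \<le> 1" and r: "r = vec_norm2 (M *\<^sub>v v)"
    using M by auto
  define w where "w = M *\<^sub>v v"
  have w: "w \<in> carrier_vec d" using M v by (simp add: w_def)
  have one: "transpose_mat (1\<^sub>m d :: real mat) = 1\<^sub>m d" by simp
  have vMw: "v \<bullet> (M *\<^sub>v w) = w \<bullet> w"
    using transpose_vec_mult_scalar[OF M w v(1)] sym M v w
    by (simp add: w_def)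
  have norm: "(w - k \<cdot>\<^sub>v v) \<bullet> (w - k \<cdot>\<^sub>v v) = w \<bullet> w - 2 * k * (v \<bullet> w) + k\<^sup>2 * (v \<bullet> v)" for k
    using symmetric_form_expand[OF one_carrier_mat one w v(1), of k] w v by simp
  have c: "w - k \<cdot>\<^sub>v v \<in> carrier_vec d" for k using w v by simp
  have "(w - (- \<kappa>) \<cdot>\<^sub>v v) \<bullet> (M *\<^sub>v (w - (- \<kappa>) \<cdot>\<^sub>v v)) \<le> \<kappa> * ((w - (- \<kappa>) \<cdot>\<^sub>v v) \<bullet> (w - (- \<kappa>) \<cdot>\<^sub>v v))"
    by (rule upper[OF c])
  moreover have "- \<kappa> * ((w - \<kappa> \<cdot>\<^sub>v v) \<bullet> (w - \<kappa> \<cdot>\<^sub>v v)) \<le> (w - \<kappa> \<cdot>\<^sub>v v) \<bullet> (M *\<^sub>v (w - \<kappa> \<cdot>\<^sub>v v))"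
    by (rule lower[OF c])
  ultimately have "4 * \<kappa> * (w \<bullet> w) \<le> 2 * \<kappa> * (w \<bullet> w) + 2 * \<kappa> * (\<kappa>\<^sup>2 * (v \<bullet> v))"
    unfolding symmetric_form_expand[OF M sym w v(1)] norm vMw by (simp add: algebra_simps)
  then have "\<kappa> * (w \<bullet> w) \<le> \<kappa> * (\<kappa>\<^sup>2 * (v \<bullet> v))" by simp
  then have "w \<bullet> w \<le> \<kappa>\<^sup>2 * (v \<bullet> v)" using \<kappa> by simp
  also have "\<dots> \<le> \<kappa>\<^sup>2"
    using v(2) by (simp add: vec_norm2_def mult_left_le)
  finally show "r \<le> \<kappa>"
    unfolding r vec_norm2_def w_def[symmetric] using \<kappa> by (simp add: real_le_lsqrt)
qed

lemma form_minus_scalar: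
  fixes A :: "real mat"
  assumes A: "A \<in> carrier_mat d d" and v: "v \<in> carrier_vec d"
  shows "v \<bullet> ((A - x \<cdot>\<^sub>m 1\<^sub>m d) *\<^sub>v v) = v \<bullet> (A *\<^sub>v v) - x * (v \<bullet> v)"
proof -
  have "(A - x \<cdot>\<^sub>m 1\<^sub>m d) *\<^sub>v v = A *\<^sub>v v - x \<cdot>\<^sub>v v"
    using A v by (simp add: minus_mult_distrib_mat_vec[of _ d d] smult_mat_mult_vec[of _ d])
  then show ?thesis
    using A v by (simp add: scalar_prod_minus_distrib[of _ d])
qed

section \<open>The two partial sums\<close>

context isotropic_vectors begin

definition partial_gram :: "nat set \<Rightarrow> real mat" where
  "partial_gram I = mat d d (\<lambda>(r, c). \<Sum>i\<in>I. u i $ r * u i $ c)"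

lemma partial_gram_carrier [simp]: "partial_gram I \<in> carrier_mat d d"
  by (simp add: partial_gram_def)

lemma partial_gram_form:
  assumes v: "v \<in> carrier_vec d"
  shows "v \<bullet> (partial_gram I *\<^sub>v v) = (\<Sum>i\<in>I. (\<Sum>c<d. u i $ c * v $ c)\<^sup>2)"
proof -
  have "v \<bullet> (partial_gram I *\<^sub>v v) = (\<Sum>r<d. \<Sum>c<d. \<Sum>i\<in>I. (u i $ r * v $ r) * (u i $ c * v $ c))"
    using v by (simp add: partial_gram_def scalar_prod_def atLeast0LessThan sum_distrib_left
        sum_distrib_right mult_ac)
  also have "\<dots> = (\<Sum>r<d. \<Sum>i\<in>I. \<Sum>c<d. (u i $ r * v $ r) * (u i $ c * v $ c))"
    by (intro sum.cong refl sum.swap)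
  also have "\<dots> = (\<Sum>i\<in>I. \<Sum>r<d. \<Sum>c<d. (u i $ r * v $ r) * (u i $ c * v $ c))"
    by (rule sum.swap)
  also have "\<dots> = (\<Sum>i\<in>I. (\<Sum>c<d. u i $ c * v $ c)\<^sup>2)"
    by (simp add: power2_eq_square sum_product)
  finally show ?thesis .
qed

lemma partial_gram_form_complement:
  assumes I: "I \<subseteq> {1..n}" and v: "v \<in> carrier_vec d"
  shows "v \<bullet> (partial_gram I *\<^sub>v v) + v \<bullet> (partial_gram ({1..n} - I) *\<^sub>v v) = v \<bullet> v"
proof -
  have "partial_gram {1..n} = 1\<^sub>m d"
    by (rule eq_matI) (use isotropic in \<open>auto simp: partial_gram_def\<close>)
  then have "v \<bullet> v = v \<bullet> (partial_gram {1..n} *\<^sub>v v)" using v by simp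
  also have "\<dots> = v \<bullet> (partial_gram ({1..n} - I) *\<^sub>v v) + v \<bullet> (partial_gram I *\<^sub>v v)"
    unfolding partial_gram_form[OF v] by (rule sum.subset_diff[OF I]) simp
  finally show ?thesis by simp
qed

lemma weighted_gram_two_values:
  assumes "I \<subseteq> {1..n}"
  shows "weighted_gram (\<lambda>i. if i \<in> I then x - 2 else x) = x \<cdot>\<^sub>m 1\<^sub>m d - 2 \<cdot>\<^sub>m partial_gram I"
proof (rule eq_matI)
  fix r c assume "r < dim_row (x \<cdot>\<^sub>m 1\<^sub>m d - 2 \<cdot>\<^sub>m partial_gram I)" "c < dim_col (x \<cdot>\<^sub>m 1\<^sub>m d - 2 \<cdot>\<^sub>m partial_gram I)"
  then have rc: "r < d" "c < d" by (auto simp: partial_gram_def)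
  have "(\<Sum>i\<in>{1..n}. (if i \<in> I then x - 2 else x) * (u i $ r * u i $ c))
     = (\<Sum>i\<in>{1..n}. x * (u i $ r * u i $ c) - (if i \<in> I then 2 * (u i $ r * u i $ c) else 0))"
    by (rule sum.cong) (auto simp: algebra_simps)
  also have "\<dots> = x * (\<Sum>i\<in>{1..n}. u i $ r * u i $ c)
      - (\<Sum>i\<in>{1..n}. if i \<in> I then 2 * (u i $ r * u i $ c) else 0)"
    by (simp only: sum_subtractf sum_distrib_left)
  also have "(\<Sum>i\<in>{1..n}. if i \<in> I then 2 * (u i $ r * u i $ c) else 0)
      = 2 * (\<Sum>i\<in>{1..n} \<inter> I. u i $ r * u i $ c)"
    unfolding sum_distrib_left by (rule sum.inter_restrict[symmetric]) simp
  also have "{1..n} \<inter> I = I" using assms by blast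
  finally have "(\<Sum>i\<in>{1..n}. (if i \<in> I then x - 2 else x) * (u i $ r * u i $ c))
     = x * (if r = c then 1 else 0) - 2 * (\<Sum>i\<in>I. u i $ r * u i $ c)"
    by (simp only: isotropic[OF rc])
  then show "weighted_gram (\<lambda>i. if i \<in> I then x - 2 else x) $$ (r, c)
      = (x \<cdot>\<^sub>m 1\<^sub>m d - 2 \<cdot>\<^sub>m partial_gram I) $$ (r, c)"
    using rc by (simp add: weighted_gram_def partial_gram_def)
qed (auto simp: weighted_gram_def partial_gram_def)

lemma partial_gram_form_le:
  assumes I: "I \<subseteq> {1..n}" and v: "v \<in> carrier_vec d"
    and nonsing: "\<And>x. \<alpha> \<le> x \<Longrightarrow> det (weighted_gram (\<lambda>i. if i \<in> I then x - 2 else x)) \<noteq> 0"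
  shows "v \<bullet> (partial_gram I *\<^sub>v v) \<le> \<alpha> / 2 * (v \<bullet> v)"
proof -
  have "v \<bullet> ((2 \<cdot>\<^sub>m partial_gram I) *\<^sub>v v) \<le> \<alpha> * (v \<bullet> v)"
  proof (rule form_le_of_nonsingular[OF _ _ _ v])
    show "transpose_mat (2 \<cdot>\<^sub>m partial_gram I) = 2 \<cdot>\<^sub>m partial_gram I"
      by (rule eq_matI) (auto simp: partial_gram_def mult.commute)
    show "det (x \<cdot>\<^sub>m 1\<^sub>m d - 2 \<cdot>\<^sub>m partial_gram I) \<noteq> 0" if "\<alpha> \<le> x" for x
      using nonsing[OF that] by (simp only: weighted_gram_two_values[OF I] not_False_eq_True)
  qed simp
  moreover have "v \<bullet> ((2 \<cdot>\<^sub>m partial_gram I) *\<^sub>v v) = 2 * (v \<bullet> (partial_gram I *\<^sub>v v))"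
    using smult_mat_mult_vec[OF partial_gram_carrier v, of 2 I] v
    by (simp add: scalar_prod_smult_distrib[of _ d] partial_gram_def)
  ultimately show ?thesis by simp
qed

text \<open>
The upper bounds for the two parts come from the selected partition. Each gives the lower bound for
the other part, since the two partial sums add up to the identity.
\<close>

lemma discrepancy_bound:
  assumes \<epsilon>: "0 < \<epsilon>" "\<epsilon> \<le> 1" and small: "\<And>i. i \<in> {1..n} \<Longrightarrow> frame_norm2 i \<le> \<epsilon>"
  shows "\<exists>S \<subseteq> {1..n}. \<forall>I \<in> {S, {1..n} - S}.
    mat_opnorm (partial_gram I - (1/2) \<cdot>\<^sub>m 1\<^sub>m d) \<le> 5/2 * sqrt \<epsilon>"
proof -
  obtain S where S: "S \<subseteq> {1..n}" and nonsing: "\<And>x. 1 + 5 * sqrt \<epsilon> \<le> x \<Longrightarrow>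
      det (weighted_gram (\<lambda>i. if i \<in> S then x - 2 else x)) \<noteq> 0 \<and>
      det (weighted_gram (\<lambda>i. if i \<in> {1..n} - S then x - 2 else x)) \<noteq> 0"
    using exists_subset_det_nonzero[OF \<epsilon> small] by blast
  have upper: "v \<bullet> (partial_gram I *\<^sub>v v) \<le> (1 + 5 * sqrt \<epsilon>) / 2 * (v \<bullet> v)"
    if I: "I = S \<or> I = {1..n} - S" and v: "v \<in> carrier_vec d" for I v
    using I
  proof
    assume "I = S"
    then show ?thesis using S nonsing v by (intro partial_gram_form_le) auto
  next
    assume eq: "I = {1..n} - S"
    show ?thesis unfolding eq by (rule partial_gram_form_le[OF _ v]) (use nonsing in blast)+
  qed
  have "mat_opnorm (partial_gram I - (1/2) \<cdot>\<^sub>m 1\<^sub>m d) \<le> 5/2 * sqrt \<epsilon>"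
    if I: "I = S \<or> I = {1..n} - S" for I
  proof (rule mat_opnorm_le_of_form_bound)
    have I': "I \<subseteq> {1..n}" and compl: "{1..n} - I = S \<or> {1..n} - I = {1..n} - S" using I S by auto
    show "partial_gram I - (1/2) \<cdot>\<^sub>m 1\<^sub>m d \<in> carrier_mat d d" by (rule minus_carrier_mat) simp
    show "transpose_mat (partial_gram I - (1/2) \<cdot>\<^sub>m 1\<^sub>m d) = partial_gram I - (1/2) \<cdot>\<^sub>m 1\<^sub>m d"
      by (rule eq_matI) (auto simp: partial_gram_def mult.commute)
    show "0 < 5/2 * sqrt \<epsilon>" using \<epsilon> by simp
    fix v :: "real vec" assume v: "v \<in> carrier_vec d"
    show "v \<bullet> ((partial_gram I - (1/2) \<cdot>\<^sub>m 1\<^sub>m d) *\<^sub>v v) \<le> 5/2 * sqrt \<epsilon> * (v \<bullet> v)"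
      unfolding form_minus_scalar[OF partial_gram_carrier v] using upper[OF I v] by (simp add: algebra_simps)
    show "- (5/2 * sqrt \<epsilon>) * (v \<bullet> v) \<le> v \<bullet> ((partial_gram I - (1/2) \<cdot>\<^sub>m 1\<^sub>m d) *\<^sub>v v)"
      unfolding form_minus_scalar[OF partial_gram_carrier v]
      using upper[OF compl v] partial_gram_form_complement[OF I' v] by (simp add: algebra_simps)
  qed
  then show ?thesis using S by blast
qed

end

lemma finsum_outer_square_eq:
  assumes "finite I" and u: "\<And>i. i \<in> I \<Longrightarrow> u i \<in> carrier_vec d"
  shows "finsum_mat TYPE(real) d d (\<lambda>i. outer_square (u i)) I = mat d d (\<lambda>(r, c). \<Sum>i\<in>I. u i $ r * u i $ c)"
proof -
  interpret comm_monoid "monoid_mat TYPE(real) d d" by (rule comm_monoid_mat)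
  have f: "(\<lambda>i. outer_square (u i)) \<in> I \<rightarrow> carrier_mat d d"
    using u outer_square_carrier by auto
  then have car: "finsum_mat TYPE(real) d d (\<lambda>i. outer_square (u i)) I \<in> carrier_mat d d"
    using finprod_closed[of "\<lambda>i. outer_square (u i)" I] unfolding finsum_mat_def by (simp add: monoid_mat_def)
  show ?thesis
  proof (rule eq_matI)
    fix r c assume "r < dim_row (mat d d (\<lambda>(r, c). \<Sum>i\<in>I. u i $ r * u i $ c))"
      "c < dim_col (mat d d (\<lambda>(r, c). \<Sum>i\<in>I. u i $ r * u i $ c))"
    then have rc: "r < d" "c < d" by auto
    show "finsum_mat TYPE(real) d d (\<lambda>i. outer_square (u i)) I $$ (r, c)
        = mat d d (\<lambda>(r, c). \<Sum>i\<in>I. u i $ r * u i $ c) $$ (r, c)"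
      unfolding index_finsum_mat[OF assms(1) f rc]
      using rc by (auto intro!: sum.cong index_outer_square u)
  qed (use car in auto)
qed

lemma mat_opnorm_dim_0: "M \<in> carrier_mat 0 0 \<Longrightarrow> mat_opnorm M \<le> 0"
  unfolding mat_opnorm_def
proof (rule cSup_least)
  assume M: "M \<in> carrier_mat 0 0"
  show "{vec_norm2 (M *\<^sub>v x) |x. x \<in> carrier_vec (dim_col M) \<and> vec_norm2 x \<le> 1} \<noteq> {}"
    using M by (auto intro!: exI[of _ "0\<^sub>v 0"] simp: vec_norm2_def)
qed (auto simp: vec_norm2_def scalar_prod_def)

theorem corollary4p5:
  shows "\<exists>K_KS :: real. K_KS > 0 \<and>
    (\<forall>(n :: nat) (d :: nat) (u :: nat \<Rightarrow> real vec) (\<epsilon> :: real).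
      (\<forall>i \<in> {1..n}. u i \<in> carrier_vec d) \<and>
      finsum_mat TYPE(real) d d (\<lambda>i. outer_square (u i)) {1..n} = 1\<^sub>m d \<and>
      (\<forall>i \<in> {1..n}. (vec_norm2 (u i))\<^sup>2 \<le> \<epsilon>) \<and> 0 \<le> \<epsilon> \<and> \<epsilon> \<le> 1
      \<longrightarrow> (\<exists>I_plus I_minus.
            I_plus \<union> I_minus = {1..n} \<and> I_plus \<inter> I_minus = {} \<and>
            (\<forall>I \<in> {I_plus, I_minus}.
              mat_opnorm (finsum_mat TYPE(real) d d (\<lambda>i. outer_square (u i)) I
                          - (1 / 2) \<cdot>\<^sub>m 1\<^sub>m d)
              \<le> K_KS * sqrt \<epsilon>)))"
proof (intro exI[of _ "5/2"] conjI allI impI)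
  show "(0::real) < 5/2" by simp
  fix n d :: nat and u :: "nat \<Rightarrow> real vec" and \<epsilon> :: real
  assume "(\<forall>i \<in> {1..n}. u i \<in> carrier_vec d) \<and>
      finsum_mat TYPE(real) d d (\<lambda>i. outer_square (u i)) {1..n} = 1\<^sub>m d \<and>
      (\<forall>i \<in> {1..n}. (vec_norm2 (u i))\<^sup>2 \<le> \<epsilon>) \<and> 0 \<le> \<epsilon> \<and> \<epsilon> \<le> 1"
  then have u: "\<And>i. i \<in> {1..n} \<Longrightarrow> u i \<in> carrier_vec d"
    and sum: "finsum_mat TYPE(real) d d (\<lambda>i. outer_square (u i)) {1..n} = 1\<^sub>m d"
    and small: "\<And>i. i \<in> {1..n} \<Longrightarrow> (vec_norm2 (u i))\<^sup>2 \<le> \<epsilon>" and \<epsilon>: "0 \<le> \<epsilon>" "\<epsilon> \<le> 1" by auto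
  interpret isotropic_vectors n d u
  proof
    fix r c assume rc: "r < d" "c < d"
    have "1\<^sub>m d = mat d d (\<lambda>(r, c). \<Sum>i\<in>{1..n}. u i $ r * u i $ c)"
      unfolding sum[symmetric] by (rule finsum_outer_square_eq) (use u in auto)
    then have "(\<Sum>i\<in>{1..n}. u i $ r * u i $ c) = (1\<^sub>m d :: real mat) $$ (r, c)"
      using rc by simp
    then show "(\<Sum>i\<in>{1..n}. u i $ r * u i $ c) = (if r = c then 1 else 0)" using rc by simp
  qed
  have eq: "finsum_mat TYPE(real) d d (\<lambda>i. outer_square (u i)) I = partial_gram I" if "I \<subseteq> {1..n}" for I
    unfolding partial_gram_def using that u finite_subset[OF that] by (intro finsum_outer_square_eq) auto
  have norm: "frame_norm2 i \<le> \<epsilon>" if "i \<in> {1..n}" for i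
  proof -
    have "frame_norm2 i = u i \<bullet> u i"
      using u[OF that] by (simp add: frame_norm2_def scalar_prod_def atLeast0LessThan power2_eq_square)
    also have "\<dots> = (vec_norm2 (u i))\<^sup>2"
      using scalar_prod_self_nonneg[of "u i"] by (simp add: vec_norm2_def)
    finally show ?thesis using small[OF that] by simp
  qed
  have "\<exists>S \<subseteq> {1..n}. \<forall>I \<in> {S, {1..n} - S}. mat_opnorm (partial_gram I - (1/2) \<cdot>\<^sub>m 1\<^sub>m d) \<le> 5/2 * sqrt \<epsilon>"
  proof (cases "\<epsilon> = 0")
    case True
    \<comment> \<open>Only the zero-dimensional space is spanned by zero vectors.\<close>
    have "d = 0"
    proof (rule ccontr)
      assume "d \<noteq> 0"
      then have d: "0 < d" by simp
      have "u i $ 0 * u i $ 0 = 0" if "i \<in> {1..n}" for i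
      proof -
        have "(u i $ 0)\<^sup>2 \<le> frame_norm2 i"
          unfolding frame_norm2_def using d by (intro member_le_sum) auto
        then have "(u i $ 0)\<^sup>2 \<le> 0" using norm[OF that] True by linarith
        then show ?thesis by simp
      qed
      then have "(\<Sum>i\<in>{1..n}. u i $ 0 * u i $ 0) = 0" by (rule sum.neutral[OF ballI])
      then show False using isotropic[OF d d] by simp
    qed
    have "partial_gram I - (1/2) \<cdot>\<^sub>m 1\<^sub>m d \<in> carrier_mat 0 0" for I
      using \<open>d = 0\<close> by (intro carrier_matI) simp_all
    from mat_opnorm_dim_0[OF this] have "mat_opnorm (partial_gram I - (1/2) \<cdot>\<^sub>m 1\<^sub>m d) \<le> 5/2 * sqrt \<epsilon>" for I
      using True by simp
    then show ?thesis by blast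
  next
    case False
    then show ?thesis using \<epsilon> norm by (intro discrepancy_bound) auto
  qed
  then obtain S where S: "S \<subseteq> {1..n}"
    and bound: "\<And>I. I \<in> {S, {1..n} - S} \<Longrightarrow> mat_opnorm (partial_gram I - (1/2) \<cdot>\<^sub>m 1\<^sub>m d) \<le> 5/2 * sqrt \<epsilon>"
    by blast
  show "\<exists>I_plus I_minus. I_plus \<union> I_minus = {1..n} \<and> I_plus \<inter> I_minus = {} \<and>
            (\<forall>I \<in> {I_plus, I_minus}.
              mat_opnorm (finsum_mat TYPE(real) d d (\<lambda>i. outer_square (u i)) I
                          - (1 / 2) \<cdot>\<^sub>m 1\<^sub>m d)
              \<le> 5/2 * sqrt \<epsilon>)"
  proof (rule exI[of _ S], rule exI[of _ "{1..n} - S"], intro conjI ballI)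
    fix I assume I: "I \<in> {S, {1..n} - S}"
    then have "I \<subseteq> {1..n}" using S by auto
    then show "mat_opnorm (finsum_mat TYPE(real) d d (\<lambda>i. outer_square (u i)) I
        - (1 / 2) \<cdot>\<^sub>m 1\<^sub>m d) \<le> 5/2 * sqrt \<epsilon>"
      using bound[OF I] by (simp only: eq)
  qed (use S in auto)
qed

end
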